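(* Let $\Lambda$ be a row-finite $k$-graph without sources, $K$ a field, and $\mathrm{KP}_K(\Lambda)$ the Kumjian--Pask algebra of $\Lambda$. Then (1) for an infinite path $x\in\Lambda^\infty$, $K[x]$ is a simple left $\mathrm{KP}_K(\Lambda)$-module; (2) for $x,y\in\Lambda^\infty$, $K[x]\cong K[y]$ as left $\mathrm{KP}_K(\Lambda)$-modules if and only if $x\sim y$; and (3) for $x\in\Lambda^\infty$, $K[x]$ is a graded module if and only if $x$ is an aperiodic path.
   Context: A $k$-graph is a countable category $\Lambda=(\Lambda^0,\Lambda,r,s)$ (objects identified with identity morphisms $\Lambda^0$; paths composed right to left, so $\lambda\mu$ is defined when $s(\lambda)=r(\mu)$) with a functor $d:\Lambda\to\mathbb{N}^k$ such that if $d(\lambda)=m+n$ there are unique $\mu,\nu\in\Lambda$ with $d(\mu)=m$, $d(\nu)=n$, $\lambda=\mu\nu$. For $v\in\Lambda^0$, $n\in\mathbb{N}^k$, $v\Lambda^n=r^{-1}(v)\cap d^{-1}(n)$. $\Lambda$ is row-finite if every $v\Lambda^n$ is finite, and has no sources if every $v\Lambda^n$ is nonempty. $\mathrm{KP}_K(\Lambda)$ is the $K$-algebra generated by $\Lambda\cup\Lambda^*$ ($\Lambda^*=\{\lambda^*\}$ formal symbols) subject to: (KP1) the elements of $\Lambda^0$ are mutually orthogonal idempotents and $v=v^*$ for $v\in\Lambda^0$; (KP2) for $r(\mu)=s(\lambda)$, the product $\lambda\mu$ equals the composite $\lambda\circ\mu$, $\mu^*\lambda^*=(\lambda\circ\mu)^*$,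 $r(\lambda)\lambda=\lambda=\lambda s(\lambda)$, $s(\lambda)\lambda^*=\lambda^*=\lambda^*r(\lambda)$; (KP3) $\lambda^*\mu=\delta_{\lambda,\mu}s(\lambda)$ whenever $d(\lambda)=d(\mu)$; (KP4) $v=\sum_{\lambda\in v\Lambda^n}\lambda\lambda^*$ for all $v\in\Lambda^0$, $n\in\mathbb{N}^k\setminus\{0\}$. It is $\mathbb{Z}^k$-graded with $\lambda\mu^*$ (for $s(\lambda)=s(\mu)$) homogeneous of degree $d(\lambda)-d(\mu)$. $\Omega_k=\{(m,n)\in\mathbb{N}^k\times\mathbb{N}^k:m\le n\}$ is the $k$-graph with $d(m,n)=n-m$, $\Omega_k^0=\mathbb{N}^k$, $r(m,n)=m$, $s(m,n)=n$, $(m,n)(n,p)=(m,p)$. An infinite path is a degree-preserving functor $x:\Omega_k\to\Lambda$; $\Lambda^\infty$ is the set of these. For $n\in\mathbb{N}^k$, $x(n,\infty)$ is the infinite path $(p,q)\mapsto x(n+p,n+q)$. $x\sim y$ (tail equivalence) if $x(n,\infty)=y(m,\infty)$ for some $n,m\in\mathbb{N}^k$; $[x]$ is the class of $x$. $x$ is aperiodic if $x(n,\infty)=x(m,\infty)$ implies $n=m$. $K[x]$ is the $K$-vector space with basis $[x]$, with the action, for $\lambda\in\Lambda$, $y\in[x]$: $\lambda\cdot y=\lambda y$ (the infinite path obtained by prepending $\lambda$) if $y(0,0)=s(\lambda)$ and $0$ otherwise; $\lambda^*\cdot y=y(d(\lambda),\infty)$ if $y(0,d(\lambda))=\lambda$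 and $0$ otherwise. "$K[x]$ is a graded module" means it admits a decomposition $K[x]=\bigoplus_{\gamma\in\mathbb{Z}^k}K[x]_\gamma$ into $K$-subspaces with $\mathrm{KP}_K(\Lambda)_\alpha K[x]_\gamma\subseteq K[x]_{\alpha+\gamma}$. *)

theory Defs
  imports
    Complex_Main
    "HOL-Library.Poly_Mapping"
    "HOL-Library.Function_Algebras"
    "HOL-Library.FuncSet"
    "HOL-Library.Countable_Set"
begin

section \<open>Higher-rank graphs\<close>

text \<open>
  The rank is the cardinality of the finite index type \<open>'k\<close>; \<open>\<nat>\<^sup>k\<close> and \<open>\<int>\<^sup>k\<close> are the function
  types \<open>'k \<Rightarrow> nat\<close> and \<open>'k \<Rightarrow> int\<close> with pointwise order and addition. Objects are identified with
  their identity morphisms, so \<open>Obj \<Lambda> \<subseteq> Mor \<Lambda>\<close>. The value \<open>pcomp \<Lambda> \<eta> \<mu>\<close> is meaningful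
  only for \<open>src \<Lambda> \<eta> = rng \<Lambda> \<mu>\<close>.
\<close>

record ('p, 'k) kgraph =
  Mor :: "'p set"
  Obj :: "'p set"
  rng :: "'p \<Rightarrow> 'p"
  src :: "'p \<Rightarrow> 'p"
  pcomp :: "'p \<Rightarrow> 'p \<Rightarrow> 'p"
  deg :: "'p \<Rightarrow> 'k \<Rightarrow> nat"

locale k_graph =
  fixes \<Lambda> :: "('p, 'k::finite) kgraph"
  assumes countable_Mor: "countable (Mor \<Lambda>)"
    and Obj_subset: "Obj \<Lambda> \<subseteq> Mor \<Lambda>"
    and rng_Obj: "\<eta> \<in> Mor \<Lambda> \<Longrightarrow> rng \<Lambda> \<eta> \<in> Obj \<Lambda>"
    and src_Obj: "\<eta> \<in> Mor \<Lambda> \<Longrightarrow> src \<Lambda> \<eta> \<in> Obj \<Lambda>"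
    and rng_id: "v \<in> Obj \<Lambda> \<Longrightarrow> rng \<Lambda> v = v"
    and src_id: "v \<in> Obj \<Lambda> \<Longrightarrow> src \<Lambda> v = v"
    and comp_closed: "\<lbrakk>\<eta> \<in> Mor \<Lambda>; \<mu> \<in> Mor \<Lambda>; src \<Lambda> \<eta> = rng \<Lambda> \<mu>\<rbrakk> \<Longrightarrow> pcomp \<Lambda> \<eta> \<mu> \<in> Mor \<Lambda>"
    and rng_comp: "\<lbrakk>\<eta> \<in> Mor \<Lambda>; \<mu> \<in> Mor \<Lambda>; src \<Lambda> \<eta> = rng \<Lambda> \<mu>\<rbrakk>
          \<Longrightarrow> rng \<Lambda> (pcomp \<Lambda> \<eta> \<mu>) = rng \<Lambda> \<eta>"
    and src_comp: "\<lbrakk>\<eta> \<in> Mor \<Lambda>; \<mu> \<in> Mor \<Lambda>; src \<Lambda> \<eta> = rng \<Lambda> \<mu>\<rbrakk>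
          \<Longrightarrow> src \<Lambda> (pcomp \<Lambda> \<eta> \<mu>) = src \<Lambda> \<mu>"
    and comp_assoc: "\<lbrakk>\<eta> \<in> Mor \<Lambda>; \<mu> \<in> Mor \<Lambda>; \<nu> \<in> Mor \<Lambda>;
          src \<Lambda> \<eta> = rng \<Lambda> \<mu>; src \<Lambda> \<mu> = rng \<Lambda> \<nu>\<rbrakk>
          \<Longrightarrow> pcomp \<Lambda> (pcomp \<Lambda> \<eta> \<mu>) \<nu> = pcomp \<Lambda> \<eta> (pcomp \<Lambda> \<mu> \<nu>)"
    and comp_id_left: "\<eta> \<in> Mor \<Lambda> \<Longrightarrow> pcomp \<Lambda> (rng \<Lambda> \<eta>) \<eta> = \<eta>"
    and comp_id_right: "\<eta> \<in> Mor \<Lambda> \<Longrightarrow> pcomp \<Lambda> \<eta> (src \<Lambda> \<eta>) = \<eta>"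
    and deg_id: "v \<in> Obj \<Lambda> \<Longrightarrow> deg \<Lambda> v = 0"
    and deg_comp: "\<lbrakk>\<eta> \<in> Mor \<Lambda>; \<mu> \<in> Mor \<Lambda>; src \<Lambda> \<eta> = rng \<Lambda> \<mu>\<rbrakk>
          \<Longrightarrow> deg \<Lambda> (pcomp \<Lambda> \<eta> \<mu>) = deg \<Lambda> \<eta> + deg \<Lambda> \<mu>"
    and unique_factorization: "\<lbrakk>\<eta> \<in> Mor \<Lambda>; deg \<Lambda> \<eta> = m + n\<rbrakk>
          \<Longrightarrow> \<exists>!p. case p of (\<mu>, \<nu>) \<Rightarrow> \<mu> \<in> Mor \<Lambda> \<and> \<nu> \<in> Mor \<Lambda> \<and> src \<Lambda> \<mu> = rng \<Lambda> \<nu> \<and>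
                deg \<Lambda> \<mu> = m \<and> deg \<Lambda> \<nu> = n \<and> \<eta> = pcomp \<Lambda> \<mu> \<nu>"

definition paths_from :: "('p, 'k) kgraph \<Rightarrow> 'p \<Rightarrow> ('k \<Rightarrow> nat) \<Rightarrow> 'p set" where
  "paths_from \<Lambda> v n = {\<eta> \<in> Mor \<Lambda>. rng \<Lambda> \<eta> = v \<and> deg \<Lambda> \<eta> = n}"

definition row_finite :: "('p, 'k) kgraph \<Rightarrow> bool" where
  "row_finite \<Lambda> \<longleftrightarrow> (\<forall>v \<in> Obj \<Lambda>. \<forall>n. finite (paths_from \<Lambda> v n))"

definition no_sources :: "('p, 'k) kgraph \<Rightarrow> bool" where
  "no_sources \<Lambda> \<longleftrightarrow> (\<forall>v \<in> Obj \<Lambda>. \<forall>n. paths_from \<Lambda> v n \<noteq> {})"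


section \<open>Infinite paths\<close>

definition Omega :: "(('k \<Rightarrow> nat) \<times> ('k \<Rightarrow> nat), 'k) kgraph" where
  "Omega = \<lparr> Mor = {(m, n). m \<le> n}, Obj = {(n, n) | n. True},
     rng = (\<lambda>(m, n). (m, m)), src = (\<lambda>(m, n). (n, n)),
     pcomp = (\<lambda>(m, n) (n', p). (m, p)), deg = (\<lambda>(m, n). n - m) \<rparr>"

lemma k_graph_Omega: "k_graph (Omega :: (_, 'k::finite) kgraph)"
proof (unfold_locales, goal_cases)
  case (15 a m n)
  then obtain p q where a: "a = (p, q)" and "p \<le> q" and q: "q - p = m + n"
    by (auto simp: Omega_def)
  then have "q = p + m + n"
    by (auto simp: fun_eq_iff le_fun_def plus_fun_def fun_diff_def) (metis add.assoc le_add_diff_inverse)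
  then show ?case
    unfolding a
    by (intro ex1I[of _ "((p, p + m), (p + m, p + m + n))"])
      (auto simp: Omega_def fun_eq_iff le_fun_def plus_fun_def fun_diff_def,
       (metis le_add_diff_inverse add.assoc)+)
qed (auto simp: Omega_def fun_eq_iff le_fun_def plus_fun_def fun_diff_def zero_fun_def
       intro: order_trans)

text \<open>
  Functors are taken to be extensional (\<open>undefined\<close> off \<open>Mor \<Gamma>\<close>), so that HOL equality of
  functions is equality of functors.
\<close>

definition degree_functor :: "('q, 'k) kgraph \<Rightarrow> ('p, 'k) kgraph \<Rightarrow> ('q \<Rightarrow> 'p) \<Rightarrow> bool" where
  "degree_functor \<Gamma> \<Lambda> x \<longleftrightarrow>
     x \<in> Mor \<Gamma> \<rightarrow>\<^sub>E Mor \<Lambda> \<and>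
     (\<forall>v \<in> Obj \<Gamma>. x v \<in> Obj \<Lambda>) \<and>
     (\<forall>a \<in> Mor \<Gamma>. rng \<Lambda> (x a) = x (rng \<Gamma> a) \<and> src \<Lambda> (x a) = x (src \<Gamma> a)
                   \<and> deg \<Lambda> (x a) = deg \<Gamma> a) \<and>
     (\<forall>a \<in> Mor \<Gamma>. \<forall>b \<in> Mor \<Gamma>. src \<Gamma> a = rng \<Gamma> b \<longrightarrow> x (pcomp \<Gamma> a b) = pcomp \<Lambda> (x a) (x b))"

type_synonym ('p, 'k) ipath = "('k \<Rightarrow> nat) \<times> ('k \<Rightarrow> nat) \<Rightarrow> 'p"

definition inf_paths :: "('p, 'k) kgraph \<Rightarrow> ('p, 'k) ipath set" where
  "inf_paths \<Lambda> = {x. degree_functor Omega \<Lambda> x}"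

text \<open>\<open>tail x n\<close> is \<open>x(n, \<infinity>)\<close>.\<close>

definition tail :: "('p, 'k) ipath \<Rightarrow> ('k \<Rightarrow> nat) \<Rightarrow> ('p, 'k) ipath" where
  "tail x n = (\<lambda>(p, q) \<in> Mor Omega. x (n + p, n + q))"

definition tail_equiv :: "('p, 'k) ipath \<Rightarrow> ('p, 'k) ipath \<Rightarrow> bool" where
  "tail_equiv x y \<longleftrightarrow> (\<exists>n m. tail x n = tail y m)"

definition tail_class :: "('p, 'k) kgraph \<Rightarrow> ('p, 'k) ipath \<Rightarrow> ('p, 'k) ipath set" where
  "tail_class \<Lambda> x = {y \<in> inf_paths \<Lambda>. tail_equiv x y}"

definition aperiodic :: "('p, 'k) ipath \<Rightarrow> bool" where
  "aperiodic x \<longleftrightarrow> (\<forall>n m. tail x n = tail x m \<longrightarrow> n = m)"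

text \<open>For \<open>src \<Lambda> \<eta> = y (0, 0)\<close>, \<open>prepend \<Lambda> \<eta> y\<close> is the infinite path \<open>\<eta>y\<close>.\<close>

definition prepend :: "('p, 'k) kgraph \<Rightarrow> 'p \<Rightarrow> ('p, 'k) ipath \<Rightarrow> ('p, 'k) ipath" where
  "prepend \<Lambda> \<eta> y = (THE z. z \<in> inf_paths \<Lambda> \<and> z (0, deg \<Lambda> \<eta>) = \<eta> \<and> tail z (deg \<Lambda> \<eta>) = y)"


section \<open>Vector spaces with a basis\<close>

text \<open>
  The space with basis \<open>B :: 'b set\<close> is \<open>{f :: 'b \<Rightarrow>\<^sub>0 'K. Poly_Mapping.keys f \<subseteq> B}\<close>.
\<close>

definition pm_scale :: "'K::field \<Rightarrow> ('b \<Rightarrow>\<^sub>0 'K) \<Rightarrow> ('b \<Rightarrow>\<^sub>0 'K)" where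
  "pm_scale c f = Poly_Mapping.map ((*) c) f"

lemma lookup_pm_scale: "Poly_Mapping.lookup (pm_scale c f) b = c * Poly_Mapping.lookup f b"
  by (simp add: pm_scale_def Poly_Mapping.map.rep_eq when_def)

interpretation pm: vector_space pm_scale
  by unfold_locales (auto intro!: poly_mapping_eqI simp: lookup_pm_scale Poly_Mapping.lookup_add algebra_simps)

definition linear_extension ::
    "('b \<Rightarrow> ('c \<Rightarrow>\<^sub>0 'K)) \<Rightarrow> ('b \<Rightarrow>\<^sub>0 'K) \<Rightarrow> ('c \<Rightarrow>\<^sub>0 'K::field)" where
  "linear_extension \<phi> f = (\<Sum>b \<in> Poly_Mapping.keys f. pm_scale (Poly_Mapping.lookup f b) (\<phi> b))"


section \<open>Algebras without unit and their left modules\<close>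

record ('K, 'a) nalgebra =
  acarrier :: "'a set"
  aadd :: "'a \<Rightarrow> 'a \<Rightarrow> 'a"
  amult :: "'a \<Rightarrow> 'a \<Rightarrow> 'a"
  ascale :: "'K \<Rightarrow> 'a \<Rightarrow> 'a"

text \<open>The addition of a module is that of the ambient type.\<close>

record ('K, 'a, 'm) lmod =
  mcarrier :: "'m set"
  mscale :: "'K \<Rightarrow> 'm \<Rightarrow> 'm"
  mact :: "'a \<Rightarrow> 'm \<Rightarrow> 'm"

locale left_module =
  fixes A :: "('K::field, 'a) nalgebra" and M :: "('K, 'a, 'm::ab_group_add) lmod"
  assumes vector_space: "vector_space (mscale M)"
    and subspace: "module.subspace (mscale M) (mcarrier M)"
    and act_closed: "\<lbrakk>a \<in> acarrier A; m \<in> mcarrier M\<rbrakk> \<Longrightarrow> mact M a m \<in> mcarrier M"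
    and act_add_left: "\<lbrakk>a \<in> acarrier A; b \<in> acarrier A; m \<in> mcarrier M\<rbrakk>
          \<Longrightarrow> mact M (aadd A a b) m = mact M a m + mact M b m"
    and act_add_right: "\<lbrakk>a \<in> acarrier A; m \<in> mcarrier M; n \<in> mcarrier M\<rbrakk>
          \<Longrightarrow> mact M a (m + n) = mact M a m + mact M a n"
    and act_scale_left: "\<lbrakk>a \<in> acarrier A; m \<in> mcarrier M\<rbrakk>
          \<Longrightarrow> mact M (ascale A c a) m = mscale M c (mact M a m)"
    and act_scale_right: "\<lbrakk>a \<in> acarrier A; m \<in> mcarrier M\<rbrakk>
          \<Longrightarrow> mact M a (mscale M c m) = mscale M c (mact M a m)"
    and act_mult: "\<lbrakk>a \<in> acarrier A; b \<in> acarrier A; m \<in> mcarrier M\<rbrakk>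
          \<Longrightarrow> mact M (amult A a b) m = mact M a (mact M b m)"

definition is_submodule ::
    "('K::field, 'a) nalgebra \<Rightarrow> ('K, 'a, 'm::ab_group_add) lmod \<Rightarrow> 'm set \<Rightarrow> bool" where
  "is_submodule A M N \<longleftrightarrow> N \<subseteq> mcarrier M \<and> module.subspace (mscale M) N \<and>
     (\<forall>a \<in> acarrier A. \<forall>n \<in> N. mact M a n \<in> N)"

text \<open>
  As usual for rings that need not have a unit, simplicity includes \<open>A M \<noteq> 0\<close>;
  this also forces \<open>M \<noteq> 0\<close>.
\<close>

definition simple_module ::
    "('K::field, 'a) nalgebra \<Rightarrow> ('K, 'a, 'm::ab_group_add) lmod \<Rightarrow> bool" where
  "simple_module A M \<longleftrightarrow> left_module A M \<and>
     (\<exists>a \<in> acarrier A. \<exists>m \<in> mcarrier M. mact M a m \<noteq> 0) \<and>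
     (\<forall>N. is_submodule A M N \<longrightarrow> N = {0} \<or> N = mcarrier M)"

definition module_isomorphic ::
    "('K::field, 'a) nalgebra \<Rightarrow> ('K, 'a, 'm::ab_group_add) lmod \<Rightarrow>
     ('K, 'a, 'n::ab_group_add) lmod \<Rightarrow> bool" where
  "module_isomorphic A M N \<longleftrightarrow> (\<exists>\<phi>. bij_betw \<phi> (mcarrier M) (mcarrier N) \<and>
     (\<forall>m \<in> mcarrier M. \<forall>m' \<in> mcarrier M. \<phi> (m + m') = \<phi> m + \<phi> m') \<and>
     (\<forall>c. \<forall>m \<in> mcarrier M. \<phi> (mscale M c m) = mscale N c (\<phi> m)) \<and>
     (\<forall>a \<in> acarrier A. \<forall>m \<in> mcarrier M. \<phi> (mact M a m) = mact N a (\<phi> m)))"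

definition direct_sum_decomposition ::
    "('K::field, 'a, 'm::ab_group_add) lmod \<Rightarrow> ('g \<Rightarrow> 'm set) \<Rightarrow> bool" where
  "direct_sum_decomposition M V \<longleftrightarrow>
     (\<forall>\<gamma>. V \<gamma> \<subseteq> mcarrier M \<and> module.subspace (mscale M) (V \<gamma>)) \<and>
     (\<forall>m \<in> mcarrier M. \<exists>!c. (\<forall>\<gamma>. c \<gamma> \<in> V \<gamma>) \<and> finite {\<gamma>. c \<gamma> \<noteq> 0} \<and>
        m = (\<Sum>\<gamma> | c \<gamma> \<noteq> 0. c \<gamma>))"

text \<open>The first argument is the family of homogeneous components of the algebra acting on \<open>M\<close>.\<close>

definition graded_module ::
    "('g::ab_group_add \<Rightarrow> 'a set) \<Rightarrow> ('K::field, 'a, 'm::ab_group_add) lmod \<Rightarrow> bool" where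
  "graded_module D M \<longleftrightarrow> (\<exists>V. direct_sum_decomposition M V \<and>
     (\<forall>\<alpha> \<gamma>. \<forall>a \<in> D \<alpha>. \<forall>m \<in> V \<gamma>. mact M a m \<in> V (\<alpha> + \<gamma>)))"


section \<open>The Kumjian--Pask algebra\<close>

datatype 'g fword = FWord (letters: "'g list")

instantiation fword :: (type) monoid_add
begin

definition zero_fword :: "'a fword" where
  "zero_fword = FWord []"

definition plus_fword :: "'a fword \<Rightarrow> 'a fword \<Rightarrow> 'a fword" where
  "plus_fword u w = FWord (letters u @ letters w)"

instance
  by standard (simp_all add: zero_fword_def plus_fword_def)

end

datatype 'p gen = Path 'p | Ghost 'p

text \<open>
  With the convolution product of \<open>poly_mapping\<close>, this type is the unital free algebra on
  \<open>'p gen\<close>. The free algebra without unit is spanned by the nonempty words.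
\<close>

type_synonym ('p, 'K) free_alg = "'p gen fword \<Rightarrow>\<^sub>0 'K"

definition gens :: "('p, 'k) kgraph \<Rightarrow> 'p gen set" where
  "gens \<Lambda> = Path ` Mor \<Lambda> \<union> Ghost ` Mor \<Lambda>"

definition free_nalg :: "('p, 'k) kgraph \<Rightarrow> ('p, 'K::field) free_alg set" where
  "free_nalg \<Lambda> = {f. \<forall>w \<in> Poly_Mapping.keys f. letters w \<noteq> [] \<and> set (letters w) \<subseteq> gens \<Lambda>}"

definition pth :: "'p \<Rightarrow> ('p, 'K::field) free_alg" where
  "pth \<eta> = Poly_Mapping.single (FWord [Path \<eta>]) 1"

definition gho :: "'p \<Rightarrow> ('p, 'K::field) free_alg" where
  "gho \<eta> = Poly_Mapping.single (FWord [Ghost \<eta>]) 1"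

inductive kp_rel ::
    "('p, 'k) kgraph \<Rightarrow> ('p, 'K::field) free_alg \<Rightarrow> ('p, 'K) free_alg \<Rightarrow> bool"
  for \<Lambda> :: "('p, 'k) kgraph" where
  KP1_idem: "\<lbrakk>v \<in> Obj \<Lambda>; w \<in> Obj \<Lambda>\<rbrakk> \<Longrightarrow> kp_rel \<Lambda> (pth v * pth w) (if v = w then pth v else 0)"
| KP1_star: "v \<in> Obj \<Lambda> \<Longrightarrow> kp_rel \<Lambda> (pth v) (gho v)"
| KP2_path: "\<lbrakk>\<eta> \<in> Mor \<Lambda>; \<mu> \<in> Mor \<Lambda>; rng \<Lambda> \<mu> = src \<Lambda> \<eta>\<rbrakk>
    \<Longrightarrow> kp_rel \<Lambda> (pth \<eta> * pth \<mu>) (pth (pcomp \<Lambda> \<eta> \<mu>))"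
| KP2_ghost: "\<lbrakk>\<eta> \<in> Mor \<Lambda>; \<mu> \<in> Mor \<Lambda>; rng \<Lambda> \<mu> = src \<Lambda> \<eta>\<rbrakk>
    \<Longrightarrow> kp_rel \<Lambda> (gho \<mu> * gho \<eta>) (gho (pcomp \<Lambda> \<eta> \<mu>))"
| KP2_rng_path: "\<eta> \<in> Mor \<Lambda> \<Longrightarrow> kp_rel \<Lambda> (pth (rng \<Lambda> \<eta>) * pth \<eta>) (pth \<eta>)"
| KP2_path_src: "\<eta> \<in> Mor \<Lambda> \<Longrightarrow> kp_rel \<Lambda> (pth \<eta> * pth (src \<Lambda> \<eta>)) (pth \<eta>)"
| KP2_src_ghost: "\<eta> \<in> Mor \<Lambda> \<Longrightarrow> kp_rel \<Lambda> (pth (src \<Lambda> \<eta>) * gho \<eta>) (gho \<eta>)"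
| KP2_ghost_rng: "\<eta> \<in> Mor \<Lambda> \<Longrightarrow> kp_rel \<Lambda> (gho \<eta> * pth (rng \<Lambda> \<eta>)) (gho \<eta>)"
| KP3: "\<lbrakk>\<eta> \<in> Mor \<Lambda>; \<mu> \<in> Mor \<Lambda>; deg \<Lambda> \<eta> = deg \<Lambda> \<mu>\<rbrakk>
    \<Longrightarrow> kp_rel \<Lambda> (gho \<eta> * pth \<mu>) (if \<eta> = \<mu> then pth (src \<Lambda> \<eta>) else 0)"
| KP4: "\<lbrakk>v \<in> Obj \<Lambda>; n \<noteq> 0\<rbrakk>
    \<Longrightarrow> kp_rel \<Lambda> (pth v) (\<Sum>\<eta> \<in> paths_from \<Lambda> v n. pth \<eta> * gho \<eta>)"

inductive_set kp_ideal :: "('p, 'k) kgraph \<Rightarrow> ('p, 'K::field) free_alg set"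
  for \<Lambda> :: "('p, 'k) kgraph" where
  rel: "kp_rel \<Lambda> f g \<Longrightarrow> f - g \<in> kp_ideal \<Lambda>"
| zero: "0 \<in> kp_ideal \<Lambda>"
| add: "\<lbrakk>f \<in> kp_ideal \<Lambda>; g \<in> kp_ideal \<Lambda>\<rbrakk> \<Longrightarrow> f + g \<in> kp_ideal \<Lambda>"
| scale: "f \<in> kp_ideal \<Lambda> \<Longrightarrow> pm_scale c f \<in> kp_ideal \<Lambda>"
| mult_left: "\<lbrakk>f \<in> kp_ideal \<Lambda>; h \<in> free_nalg \<Lambda>\<rbrakk> \<Longrightarrow> h * f \<in> kp_ideal \<Lambda>"
| mult_right: "\<lbrakk>f \<in> kp_ideal \<Lambda>; h \<in> free_nalg \<Lambda>\<rbrakk> \<Longrightarrow> f * h \<in> kp_ideal \<Lambda>"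

definition kp_cong :: "('p, 'k) kgraph \<Rightarrow> ('p, 'K::field) free_alg rel" where
  "kp_cong \<Lambda> = {(f, g). f \<in> free_nalg \<Lambda> \<and> g \<in> free_nalg \<Lambda> \<and> f - g \<in> kp_ideal \<Lambda>}"

type_synonym ('p, 'K) kp_elem = "('p, 'K) free_alg set"

definition KP :: "('p, 'k) kgraph \<Rightarrow> ('K::field, ('p, 'K) kp_elem) nalgebra" where
  "KP \<Lambda> = \<lparr> acarrier = free_nalg \<Lambda> // kp_cong \<Lambda>,
     aadd = (\<lambda>X Y. \<Union>f \<in> X. \<Union>g \<in> Y. kp_cong \<Lambda> `` {f + g}),
     amult = (\<lambda>X Y. \<Union>f \<in> X. \<Union>g \<in> Y. kp_cong \<Lambda> `` {f * g}),
     ascale = (\<lambda>c X. \<Union>f \<in> X. kp_cong \<Lambda> `` {pm_scale c f}) \<rparr>"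

definition KP_component ::
    "('p, 'k) kgraph \<Rightarrow> ('k \<Rightarrow> int) \<Rightarrow> ('p, 'K::field) kp_elem set" where
  "KP_component \<Lambda> \<alpha> = (\<lambda>f. kp_cong \<Lambda> `` {f}) ` pm.span
     {pth \<eta> * gho \<mu> | \<eta> \<mu>. \<eta> \<in> Mor \<Lambda> \<and> \<mu> \<in> Mor \<Lambda> \<and> src \<Lambda> \<eta> = src \<Lambda> \<mu> \<and>
        \<alpha> = (\<lambda>i. int (deg \<Lambda> \<eta> i) - int (deg \<Lambda> \<mu> i))}"


section \<open>The module of a tail-equivalence class\<close>

fun gen_act :: "('p, 'k) kgraph \<Rightarrow> 'p gen \<Rightarrow> ('p, 'k) ipath \<Rightarrow> (('p, 'k) ipath \<Rightarrow>\<^sub>0 'K::field)" where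
  "gen_act \<Lambda> (Path \<eta>) y =
     (if y (0, 0) = src \<Lambda> \<eta> then Poly_Mapping.single (prepend \<Lambda> \<eta> y) 1 else 0)"
| "gen_act \<Lambda> (Ghost \<eta>) y =
     (if y (0, deg \<Lambda> \<eta>) = \<eta> then Poly_Mapping.single (tail y (deg \<Lambda> \<eta>)) 1 else 0)"

definition word_act ::
    "('p, 'k) kgraph \<Rightarrow> 'p gen fword \<Rightarrow> (('p, 'k) ipath \<Rightarrow>\<^sub>0 'K) \<Rightarrow>
     (('p, 'k) ipath \<Rightarrow>\<^sub>0 'K::field)" where
  "word_act \<Lambda> w m = foldr (\<lambda>g. linear_extension (gen_act \<Lambda> g)) (letters w) m"

definition free_act ::
    "('p, 'k) kgraph \<Rightarrow> ('p, 'K) free_alg \<Rightarrow> (('p, 'k) ipath \<Rightarrow>\<^sub>0 'K) \<Rightarrow>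
     (('p, 'k) ipath \<Rightarrow>\<^sub>0 'K::field)" where
  "free_act \<Lambda> f m = linear_extension (\<lambda>w. word_act \<Lambda> w m) f"

text \<open>
  An element of the Kumjian--Pask algebra acts as the common value of the actions of its
  representatives; that these agree on \<open>K[x]\<close> is the assertion that the generators act
  compatibly with (KP1)--(KP4).
\<close>

definition kp_act ::
    "('p, 'k) kgraph \<Rightarrow> ('p, 'K) kp_elem \<Rightarrow> (('p, 'k) ipath \<Rightarrow>\<^sub>0 'K) \<Rightarrow>
     (('p, 'k) ipath \<Rightarrow>\<^sub>0 'K::field)" where
  "kp_act \<Lambda> X m = (THE u. \<forall>f \<in> X. free_act \<Lambda> f m = u)"

type_synonym ('p, 'k, 'K) path_module = "('K, ('p, 'K) kp_elem, ('p, 'k) ipath \<Rightarrow>\<^sub>0 'K) lmod"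

definition path_module ::
    "('p, 'k) kgraph \<Rightarrow> ('p, 'k) ipath \<Rightarrow> ('p, 'k, 'K::field) path_module" where
  "path_module \<Lambda> x = \<lparr> mcarrier = {m. Poly_Mapping.keys m \<subseteq> tail_class \<Lambda> x},
     mscale = pm_scale, mact = kp_act \<Lambda> \<rparr>"

end

theory Submission
  imports Defs
begin

text \<open>
  Distinct infinite paths \<open>y\<close> and \<open>z\<close> differ on some initial segment, so for \<open>m\<close> in \<open>K[x]\<close> with \<open>y\<close> in its
  support and \<open>n\<close> large, the ghost path \<open>y(0, n)\<^sup>*\<close> sends \<open>m\<close> to a nonzero multiple of \<open>y(n, \<infinity>)\<close>, and
  from this basis vector every element of \<open>[x]\<close> is reached by a ghost path followed by a path. This
  gives simplicity. In the same way, if \<open>x\<close> is not tail equivalent to \<open>y\<close>, then \<open>x(0, n) x(0, n)\<^sup>*\<close>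
  fixes \<open>x\<close> but kills the image of \<open>x\<close> in \<open>K[y]\<close>.

  If \<open>x\<close> is aperiodic, \<open>y(m, \<infinity>) = x(n, \<infinity>)\<close> determines \<open>m - n\<close>, which grades the basis \<open>[x]\<close>. If
  \<open>x(n, \<infinity>) = x(m, \<infinity>)\<close> with \<open>n \<noteq> m\<close>, then \<open>x(0, n) x(0, m)\<^sup>*\<close> is homogeneous of degree
  \<open>n - m \<noteq> 0\<close> and fixes \<open>x\<close>, so in a grading the finite set of degrees of \<open>x\<close> would be invariant
  under a nonzero translation.
\<close>

section \<open>Spaces with a basis and linear extension\<close>

lemma poly_mapping_sum_single:
  "(\<Sum>b \<in> Poly_Mapping.keys f. Poly_Mapping.single b (Poly_Mapping.lookup f b)) = f"
  by (rule poly_mapping_eqI)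
    (simp add: lookup_sum lookup_single when_def in_keys_iff)

lemma pm_scale_single: "pm_scale c (Poly_Mapping.single b d) = Poly_Mapping.single b (c * d)"
  by (rule poly_mapping_eqI) (simp add: lookup_pm_scale lookup_single when_def)

lemma keys_pm_scale_subset: "Poly_Mapping.keys (pm_scale c f) \<subseteq> Poly_Mapping.keys f"
  by (auto simp: in_keys_iff lookup_pm_scale)

lemma subspace_keys_subset: "pm.subspace {m :: 'b \<Rightarrow>\<^sub>0 'K::field. Poly_Mapping.keys m \<subseteq> S}"
  by (auto simp: pm.subspace_def
      dest!: subsetD[OF Poly_Mapping.keys_add] subsetD[OF keys_pm_scale_subset])

lemma linear_extension_superset:
  assumes "finite S" "Poly_Mapping.keys f \<subseteq> S"
  shows "linear_extension \<phi> f = (\<Sum>b \<in> S. pm_scale (Poly_Mapping.lookup f b) (\<phi> b))"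
  unfolding linear_extension_def using assms
  by (intro sum.mono_neutral_left) (auto simp: in_keys_iff)

lemma linear_extension_single [simp]:
  "linear_extension \<phi> (Poly_Mapping.single b c) = pm_scale c (\<phi> b)"
  by (subst linear_extension_superset[of "{b}"]) auto

lemma module_hom_linear_extension: "module_hom pm_scale pm_scale (linear_extension \<phi>)"
proof -
  have "linear_extension \<phi> (f + g) = linear_extension \<phi> f + linear_extension \<phi> g" for f g
  proof -
    let ?S = "Poly_Mapping.keys f \<union> Poly_Mapping.keys g"
    show ?thesis
      using Poly_Mapping.keys_add[of f g]
      by (simp add: linear_extension_superset[of ?S] Poly_Mapping.lookup_add pm.scale_left_distrib sum.distrib)
  qed
  moreover have "linear_extension \<phi> (pm_scale c f) = pm_scale c (linear_extension \<phi> f)" for c f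
    using keys_pm_scale_subset[of c f]
    by (simp add: linear_extension_superset[of "Poly_Mapping.keys f"] lookup_pm_scale pm.scale_sum_right)
  ultimately show ?thesis
    by (simp add: module_hom_iff pm.module_axioms)
qed

lemma keys_linear_extension:
  assumes "\<And>b. b \<in> Poly_Mapping.keys f \<Longrightarrow> Poly_Mapping.keys (\<phi> b) \<subseteq> S"
  shows "Poly_Mapping.keys (linear_extension \<phi> f) \<subseteq> S"
proof -
  have "linear_extension \<phi> f \<in> {m. Poly_Mapping.keys m \<subseteq> S}"
    unfolding linear_extension_def
    by (intro pm.subspace_sum pm.subspace_scale subspace_keys_subset) (use assms in auto)
  then show ?thesis by simp
qed

text \<open>Expanding \<open>f\<close> in basis vectors reduces the claim to those vectors. The
  restriction to \<open>S\<close> matters because the index type of K[x] also contains functions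
  that are not infinite paths, while the Kumjian-Pask relations are checked on infinite paths
  only.\<close>

lemma module_hom_eq_on_singles:
  assumes "module_hom pm_scale pm_scale L" "module_hom pm_scale pm_scale L'"
    and "\<And>b. b \<in> S \<Longrightarrow> L (Poly_Mapping.single b 1) = L' (Poly_Mapping.single b 1)"
    and "Poly_Mapping.keys f \<subseteq> S"
  shows "L f = L' f"
proof -
  interpret L: module_hom pm_scale pm_scale L by fact
  interpret L': module_hom pm_scale pm_scale L' by fact
  let ?g = "\<lambda>b. pm_scale (Poly_Mapping.lookup f b) (Poly_Mapping.single b 1)"
  have "L (\<Sum>b \<in> Poly_Mapping.keys f. ?g b) = L' (\<Sum>b \<in> Poly_Mapping.keys f. ?g b)"
    unfolding L.sum L'.sum L.scale L'.scale
    by (intro sum.cong) (use assms(3,4) in auto)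
  then show ?thesis
    by (simp add: pm_scale_single poly_mapping_sum_single)
qed

section \<open>Words and elements of the free algebra as linear operators\<close>

lemma word_act_plus: "word_act \<Lambda> (u + w) m = word_act \<Lambda> u (word_act \<Lambda> w m)"
  by (simp add: word_act_def plus_fword_def)

lemma module_hom_word_act:
  "module_hom pm_scale pm_scale
     (word_act \<Lambda> w :: (('p, 'k) ipath \<Rightarrow>\<^sub>0 'K::field) \<Rightarrow> (('p, 'k) ipath \<Rightarrow>\<^sub>0 'K))"
proof -
  have "module_hom pm_scale pm_scale
     (foldr (\<lambda>g. linear_extension (gen_act \<Lambda> g)) gs
        :: (('p, 'k) ipath \<Rightarrow>\<^sub>0 'K) \<Rightarrow> (('p, 'k) ipath \<Rightarrow>\<^sub>0 'K))" for gs
  proof (induction gs)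
    case Nil
    then show ?case by (simp add: module_hom_iff pm.module_axioms)
  next
    case (Cons g gs)
    show ?case
      using module_hom_compose[OF Cons module_hom_linear_extension[of "gen_act \<Lambda> g"]] by (simp add: comp_def)
  qed
  then show ?thesis
    unfolding word_act_def .
qed

lemma module_hom_free_act_left:
  "module_hom pm_scale pm_scale (\<lambda>f. free_act \<Lambda> f m)"
  unfolding free_act_def by (rule module_hom_linear_extension)

lemma module_hom_free_act:
  "module_hom pm_scale pm_scale
     (free_act \<Lambda> f :: (('p, 'k) ipath \<Rightarrow>\<^sub>0 'K::field) \<Rightarrow> (('p, 'k) ipath \<Rightarrow>\<^sub>0 'K))"
proof -
  interpret W: module_hom pm_scale pm_scale "word_act \<Lambda> w
      :: (('p, 'k) ipath \<Rightarrow>\<^sub>0 'K::field) \<Rightarrow> (('p, 'k) ipath \<Rightarrow>\<^sub>0 'K)" for w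
    by (rule module_hom_word_act)
  show ?thesis
    unfolding module_hom_iff free_act_def linear_extension_def
    by (auto simp: pm.module_axioms W.add W.scale pm.scale_right_distrib sum.distrib pm.scale_sum_right
        mult.commute)
qed

lemmas free_act_add_left = module_hom.add[OF module_hom_free_act_left]
  and free_act_diff_left = module_hom.diff[OF module_hom_free_act_left]
  and free_act_scale_left = module_hom.scale[OF module_hom_free_act_left]
  and free_act_sum_left = module_hom.sum[OF module_hom_free_act_left]
  and free_act_zero_left = module_hom.zero[OF module_hom_free_act_left]
  and free_act_add_right = module_hom.add[OF module_hom_free_act]
  and free_act_scale_right = module_hom.scale[OF module_hom_free_act]
  and free_act_sum_right = module_hom.sum[OF module_hom_free_act]
  and free_act_zero_right = module_hom.zero[OF module_hom_free_act]

lemma free_act_single: "free_act \<Lambda> (Poly_Mapping.single w c) m = pm_scale c (word_act \<Lambda> w m)"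
  by (simp add: free_act_def)

text \<open>The convolution product concatenates words, and a concatenated word acts by composing
  the two operators; both sides become the same double sum over pairs of words.\<close>

lemma free_act_times:
  fixes f g :: "('p, 'K::field) free_alg" and m :: "('p, 'k) ipath \<Rightarrow>\<^sub>0 'K"
  shows "free_act \<Lambda> (f * g) m = free_act \<Lambda> f (free_act \<Lambda> g m)"
proof -
  interpret W: module_hom pm_scale pm_scale "word_act \<Lambda> w
      :: (('p, 'k) ipath \<Rightarrow>\<^sub>0 'K::field) \<Rightarrow> (('p, 'k) ipath \<Rightarrow>\<^sub>0 'K)" for w
    by (rule module_hom_word_act)
  have "f * g = (\<Sum>u \<in> Poly_Mapping.keys f. \<Sum>w \<in> Poly_Mapping.keys g.
      Poly_Mapping.single (u + w) (Poly_Mapping.lookup f u * Poly_Mapping.lookup g w))"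
    by (subst (1 2) poly_mapping_sum_single[symmetric])
      (simp add: sum_product Poly_Mapping.mult_single)
  then have "free_act \<Lambda> (f * g) m = (\<Sum>u \<in> Poly_Mapping.keys f. \<Sum>w \<in> Poly_Mapping.keys g.
      pm_scale (Poly_Mapping.lookup f u * Poly_Mapping.lookup g w) (word_act \<Lambda> u (word_act \<Lambda> w m)))"
    by (simp add: free_act_sum_left free_act_single word_act_plus)
  also have "\<dots> = free_act \<Lambda> f (free_act \<Lambda> g m)"
    by (simp add: free_act_def linear_extension_def W.sum W.scale pm.scale_sum_right)
  finally show ?thesis .
qed

lemma free_act_pth_single:
  "free_act \<Lambda> (pth \<eta>) (Poly_Mapping.single y 1) =
     (if y (0, 0) = src \<Lambda> \<eta> then Poly_Mapping.single (prepend \<Lambda> \<eta> y) 1 else 0)"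
  by (simp add: pth_def free_act_single word_act_def)

lemma free_act_gho_single:
  "free_act \<Lambda> (gho \<eta>) (Poly_Mapping.single y 1) =
     (if y (0, deg \<Lambda> \<eta>) = \<eta> then Poly_Mapping.single (tail y (deg \<Lambda> \<eta>)) 1 else 0)"
  by (simp add: gho_def free_act_single word_act_def)

text \<open>Letters act one at a time, so invariance of the span of \<open>S\<close> follows from
  invariance under single generators on basis vectors. It is used with \<open>S\<close> a tail
  class.\<close>

lemma keys_free_act:
  fixes f :: "('p, 'K::field) free_alg" and m :: "('p, 'k) ipath \<Rightarrow>\<^sub>0 'K"
  assumes f: "f \<in> free_nalg \<Lambda>" and m: "Poly_Mapping.keys m \<subseteq> S"
    and gen: "\<And>g y. g \<in> gens \<Lambda> \<Longrightarrow> y \<in> S \<Longrightarrow> Poly_Mapping.keys (gen_act \<Lambda> g y :: _ \<Rightarrow>\<^sub>0 'K) \<subseteq> S"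
  shows "Poly_Mapping.keys (free_act \<Lambda> f m) \<subseteq> S"
proof -
  have "Poly_Mapping.keys (foldr (\<lambda>g. linear_extension (gen_act \<Lambda> g)) gs m) \<subseteq> S"
    if "set gs \<subseteq> gens \<Lambda>" for gs
    using that
  proof (induction gs)
    case (Cons g gs)
    then have "Poly_Mapping.keys (foldr (\<lambda>g. linear_extension (gen_act \<Lambda> g)) gs m) \<subseteq> S"
      by simp
    then have "Poly_Mapping.keys (linear_extension (gen_act \<Lambda> g)
        (foldr (\<lambda>g. linear_extension (gen_act \<Lambda> g)) gs m)) \<subseteq> S"
      using Cons.prems by (intro keys_linear_extension gen) auto
    then show ?case by simp
  qed (use m in simp)
  then show ?thesis
    unfolding free_act_def word_act_def using f
    by (intro keys_linear_extension) (auto simp: free_nalg_def)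
qed

section \<open>Infinite paths\<close>

lemma nat_fun_le_iff: "m \<le> n \<longleftrightarrow> (\<exists>l. n = m + l)" for m n :: "'k \<Rightarrow> nat"
proof
  assume "m \<le> n"
  then have "n = m + (n - m)" by (auto simp: fun_eq_iff le_fun_def)
  then show "\<exists>l. n = m + l" by (rule exI[where x = "n - m"])
qed (auto simp: le_fun_def)

lemma nat_fun_zero_le [simp]: "0 \<le> n" for n :: "'k \<Rightarrow> nat"
  by (simp add: le_fun_def)

lemma nat_fun_le_add [simp]: "m \<le> m + n" for m n :: "'k \<Rightarrow> nat"
  by (simp add: le_fun_def)

lemma nat_fun_add_diff_cancel [simp]: "(m + n) - m = n" for m n :: "'k \<Rightarrow> nat"
  by (simp add: fun_eq_iff)

lemma nat_fun_add_diff_add [simp]: "(l + n) - (l + m) = n - m" for l m n :: "'k \<Rightarrow> nat"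
  by (simp add: fun_eq_iff)

lemma Omega_simps [simp]:
  "(m, n) \<in> Mor Omega \<longleftrightarrow> m \<le> n" "(m, n) \<in> Obj Omega \<longleftrightarrow> m = n"
  "rng Omega (m, n) = (m, m)" "src Omega (m, n) = (n, n)"
  "pcomp Omega (m, n) (n', p) = (m, p)" "deg Omega (m, n) = n - m"
  by (auto simp: Omega_def)

lemma tail_apply [simp]: "p \<le> q \<Longrightarrow> tail x n (p, q) = x (n + p, n + q)"
  by (simp add: tail_def)

lemma tail_undefined: "\<not> p \<le> q \<Longrightarrow> tail x n (p, q) = undefined"
  by (simp add: tail_def)

lemma tail_tail: "tail (tail x n) m = tail x (n + m)"
proof
  fix a
  show "tail (tail x n) m a = tail x (n + m) a"
    by (cases a; cases "fst a \<le> snd a") (auto simp: tail_undefined add.assoc add_left_mono)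
qed

lemma tail_equiv_refl: "tail_equiv x x"
  unfolding tail_equiv_def by blast

lemma tail_equiv_sym: "tail_equiv x y \<Longrightarrow> tail_equiv y x"
  unfolding tail_equiv_def by metis

text \<open>The two tails of \<open>y\<close> involved are each shifted further by the offset of the
  other, so that both become the tail of \<open>y\<close> at the sum of the offsets.\<close>

lemma tail_equiv_trans: "tail_equiv x y \<Longrightarrow> tail_equiv y z \<Longrightarrow> tail_equiv x z"
  unfolding tail_equiv_def by (metis add.commute tail_tail)

lemma tail_class_cong: "tail_equiv x y \<Longrightarrow> tail_class \<Lambda> x = tail_class \<Lambda> y"
  unfolding tail_class_def by (blast intro: tail_equiv_sym tail_equiv_trans)

section \<open>Unique factorization and initial segments of infinite paths\<close>

context k_graph
begin

text \<open>Additivity of the degree and cancellation in N^k give \<open>b\<close> and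
  \<open>d\<close> equal degrees, so both pairs factor one morphism at the same degrees and unique
  factorization applies. Most identities between segments below rest on this.\<close>

lemma comp_cancel:
  assumes "a \<in> Mor \<Lambda>" "b \<in> Mor \<Lambda>" "src \<Lambda> a = rng \<Lambda> b"
    and "c \<in> Mor \<Lambda>" "d \<in> Mor \<Lambda>" "src \<Lambda> c = rng \<Lambda> d"
    and eq: "pcomp \<Lambda> a b = pcomp \<Lambda> c d" and "deg \<Lambda> a = deg \<Lambda> c"
  shows "a = c" "b = d"
proof -
  have dab: "deg \<Lambda> (pcomp \<Lambda> a b) = deg \<Lambda> a + deg \<Lambda> b"
    using assms(1-3) by (simp add: deg_comp)
  have dcd: "deg \<Lambda> (pcomp \<Lambda> a b) = deg \<Lambda> c + deg \<Lambda> d"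
    unfolding eq using assms(4-6) by (simp add: deg_comp)
  have "deg \<Lambda> b = deg \<Lambda> d"
    using dab dcd assms(8) by simp
  moreover note ex1 = unique_factorization[OF comp_closed[OF assms(1-3)] dab]
  ultimately have "(a, b) = (c, d)"
    by (intro trans[OF sym[OF the1_equality[OF ex1]] the1_equality[OF ex1]]) (simp_all add: assms)
  then show "a = c" "b = d" by auto
qed

text \<open>This spells out \<open>degree_functor\<close> on the pairs (m, n) of
  \<open>Omega\<close>. That vertices go to objects is recovered from the range equation at (n, n),
  which makes x(n, n) the range of a morphism.\<close>

lemma inf_paths_iff:
  "x \<in> inf_paths \<Lambda> \<longleftrightarrow>
     (\<forall>m n. m \<le> n \<longrightarrow> x (m, n) \<in> Mor \<Lambda> \<and> rng \<Lambda> (x (m, n)) = x (m, m) \<and>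
        src \<Lambda> (x (m, n)) = x (n, n) \<and> deg \<Lambda> (x (m, n)) = n - m) \<and>
     (\<forall>m n. \<not> m \<le> n \<longrightarrow> x (m, n) = undefined) \<and>
     (\<forall>m n p. m \<le> n \<longrightarrow> n \<le> p \<longrightarrow> x (m, p) = pcomp \<Lambda> (x (m, n)) (x (n, p)))"
  (is "_ \<longleftrightarrow> ?R")
proof
  assume "x \<in> inf_paths \<Lambda>"
  then have x: "degree_functor Omega \<Lambda> x"
    by (simp add: inf_paths_def)
  then have ext: "x \<in> Mor Omega \<rightarrow>\<^sub>E Mor \<Lambda>"
    and rsd: "\<And>a. a \<in> Mor Omega \<Longrightarrow> rng \<Lambda> (x a) = x (rng Omega a) \<and> src \<Lambda> (x a) = x (src Omega a)
                   \<and> deg \<Lambda> (x a) = deg Omega a"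
    and comp: "\<And>a b. a \<in> Mor Omega \<Longrightarrow> b \<in> Mor Omega \<Longrightarrow> src Omega a = rng Omega b
                 \<Longrightarrow> x (pcomp Omega a b) = pcomp \<Lambda> (x a) (x b)"
    unfolding degree_functor_def by blast+
  have "x (m, p) = pcomp \<Lambda> (x (m, n)) (x (n, p))" if "m \<le> n" "n \<le> p" for m n p
    using comp[of "(m, n)" "(n, p)"] that by simp
  moreover have "x (m, n) = undefined" if "\<not> m \<le> n" for m n
    using PiE_arb[OF ext, of "(m, n)"] that by simp
  moreover have "x (m, n) \<in> Mor \<Lambda>" if "m \<le> n" for m n
    using PiE_mem[OF ext, of "(m, n)"] that by simp
  moreover have "rng \<Lambda> (x (m, n)) = x (m, m) \<and>
        src \<Lambda> (x (m, n)) = x (n, n) \<and> deg \<Lambda> (x (m, n)) = n - m" if "m \<le> n" for m n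
    using rsd[of "(m, n)"] that by simp
  ultimately show ?R by blast
next
  assume R: ?R
  have Mor: "x (m, n) \<in> Mor \<Lambda>" and rng: "rng \<Lambda> (x (m, n)) = x (m, m)"
    and src: "src \<Lambda> (x (m, n)) = x (n, n)" and deg: "deg \<Lambda> (x (m, n)) = n - m" if "m \<le> n" for m n
    using R that by blast+
  have comp: "x (m, p) = pcomp \<Lambda> (x (m, n)) (x (n, p))" if "m \<le> n" "n \<le> p" for m n p
    using R that by blast
  have undef: "x (m, n) = undefined" if "\<not> m \<le> n" for m n
    using R that by blast
  have "x \<in> Mor Omega \<rightarrow>\<^sub>E Mor \<Lambda>"
  proof (rule PiE_I)
    fix a :: "('k \<Rightarrow> nat) \<times> ('k \<Rightarrow> nat)"
    show "a \<in> Mor Omega \<Longrightarrow> x a \<in> Mor \<Lambda>"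
      by (cases a) (simp add: Mor)
    show "a \<notin> Mor Omega \<Longrightarrow> x a = undefined"
      using undef by (cases a) simp
  qed
  moreover have "x (n, n) \<in> Obj \<Lambda>" for n
    using rng_Obj[OF Mor[of n n]] rng[of n n] by simp
  then have "\<forall>v \<in> Obj Omega. x v \<in> Obj \<Lambda>"
    by auto
  moreover have "\<forall>a \<in> Mor Omega. rng \<Lambda> (x a) = x (rng Omega a) \<and> src \<Lambda> (x a) = x (src Omega a)
      \<and> deg \<Lambda> (x a) = deg Omega a"
    by (auto simp: rng src deg)
  moreover have "\<forall>a \<in> Mor Omega. \<forall>b \<in> Mor Omega. src Omega a = rng Omega b \<longrightarrow>
      x (pcomp Omega a b) = pcomp \<Lambda> (x a) (x b)"
    by (auto intro: comp)
  ultimately show "x \<in> inf_paths \<Lambda>"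
    unfolding inf_paths_def degree_functor_def by blast
qed

lemma inf_path_Mor [simp]: "x \<in> inf_paths \<Lambda> \<Longrightarrow> m \<le> n \<Longrightarrow> x (m, n) \<in> Mor \<Lambda>"
  and inf_path_rng [simp]: "x \<in> inf_paths \<Lambda> \<Longrightarrow> m \<le> n \<Longrightarrow> rng \<Lambda> (x (m, n)) = x (m, m)"
  and inf_path_src [simp]: "x \<in> inf_paths \<Lambda> \<Longrightarrow> m \<le> n \<Longrightarrow> src \<Lambda> (x (m, n)) = x (n, n)"
  and inf_path_deg [simp]: "x \<in> inf_paths \<Lambda> \<Longrightarrow> m \<le> n \<Longrightarrow> deg \<Lambda> (x (m, n)) = n - m"
  and inf_path_undefined: "x \<in> inf_paths \<Lambda> \<Longrightarrow> \<not> m \<le> n \<Longrightarrow> x (m, n) = undefined"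
  and inf_path_comp: "x \<in> inf_paths \<Lambda> \<Longrightarrow> m \<le> n \<Longrightarrow> n \<le> p \<Longrightarrow> pcomp \<Lambda> (x (m, n)) (x (n, p)) = x (m, p)"
  unfolding inf_paths_iff by metis+

lemma inf_path_Obj [simp]: "x \<in> inf_paths \<Lambda> \<Longrightarrow> x (n, n) \<in> Obj \<Lambda>"
  using rng_Obj[of "x (n, n)"] by simp

lemma inf_path_init_mono:
  assumes x: "x \<in> inf_paths \<Lambda>" and y: "y \<in> inf_paths \<Lambda>"
    and "m \<le> n" "x (0, n) = y (0, n)"
  shows "x (0, m) = y (0, m)"
proof (rule comp_cancel(1))
  show "pcomp \<Lambda> (x (0, m)) (x (m, n)) = pcomp \<Lambda> (y (0, m)) (y (m, n))"
    using inf_path_comp[OF x, of 0 m n] inf_path_comp[OF y, of 0 m n] assms(3,4) by simp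
qed (use assms(1-3) in simp_all)

text \<open>Initial segments determine a path: x(p, q) is what remains of x(0, q) after cancelling
  x(0, p). The segments at the degrees N + n determine all shorter ones; the offset \<open>N\<close>
  serves paths known only beyond a given prefix.\<close>

lemma inf_path_eqI:
  assumes x: "x \<in> inf_paths \<Lambda>" and y: "y \<in> inf_paths \<Lambda>"
    and eq: "\<And>n. x (0, N + n) = y (0, N + n)"
  shows "x = y"
proof
  have init: "x (0, q) = y (0, q)" for q
    using inf_path_init_mono[OF x y _ eq[of q], of q] by (simp add: le_fun_def)
  fix a :: "('k \<Rightarrow> nat) \<times> ('k \<Rightarrow> nat)"
  obtain p q where a: "a = (p, q)" by (cases a)
  show "x a = y a"
  proof (cases "p \<le> q")
    case True
    show ?thesis
      unfolding a
    proof (rule comp_cancel(2))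
      show "pcomp \<Lambda> (x (0, p)) (x (p, q)) = pcomp \<Lambda> (y (0, p)) (y (p, q))"
        using inf_path_comp[OF x, of 0 p q] inf_path_comp[OF y, of 0 p q] init[of q] True by simp
      have "x (p, p) = y (p, p)"
        using inf_path_src[OF x, of 0 p] inf_path_src[OF y, of 0 p] init[of p] by simp
      then show "src \<Lambda> (x (0, p)) = rng \<Lambda> (x (p, q))" "src \<Lambda> (y (0, p)) = rng \<Lambda> (y (p, q))"
        using x y True by simp_all
    qed (use x y True in simp_all)
  next
    case False
    then show ?thesis
      using inf_path_undefined[OF x, of p q] inf_path_undefined[OF y, of p q] a by simp
  qed
qed


text \<open>Existence counterpart of \<open>inf_path_eqI\<close>. The value at (m, n) must be the
  complement of \<sigma> m in \<sigma> n, and these complements are functorial because cancellation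
  makes them unique.\<close>

lemma inf_path_of_segments:
  assumes Mor: "\<And>n. \<sigma> n \<in> Mor \<Lambda>" and deg: "\<And>n. deg \<Lambda> (\<sigma> n) = n"
    and seg: "\<And>m n. m \<le> n \<Longrightarrow> \<exists>\<nu> \<in> Mor \<Lambda>. src \<Lambda> (\<sigma> m) = rng \<Lambda> \<nu> \<and> \<sigma> n = pcomp \<Lambda> (\<sigma> m) \<nu>"
  shows "\<exists>x \<in> inf_paths \<Lambda>. \<forall>n. x (0, n) = \<sigma> n"
proof -
  obtain \<nu> where \<nu>_Mor: "\<And>m n. m \<le> n \<Longrightarrow> \<nu> m n \<in> Mor \<Lambda>"
    and src_\<sigma>: "\<And>m n. m \<le> n \<Longrightarrow> src \<Lambda> (\<sigma> m) = rng \<Lambda> (\<nu> m n)"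
    and \<sigma>\<nu>: "\<And>m n. m \<le> n \<Longrightarrow> pcomp \<Lambda> (\<sigma> m) (\<nu> m n) = \<sigma> n"
  proof
    define \<nu> where "\<nu> m n = (SOME \<rho>. \<rho> \<in> Mor \<Lambda> \<and> src \<Lambda> (\<sigma> m) = rng \<Lambda> \<rho> \<and> \<sigma> n = pcomp \<Lambda> (\<sigma> m) \<rho>)" for m n
    have \<nu>: "\<nu> m n \<in> Mor \<Lambda> \<and> src \<Lambda> (\<sigma> m) = rng \<Lambda> (\<nu> m n) \<and> \<sigma> n = pcomp \<Lambda> (\<sigma> m) (\<nu> m n)"
      if "m \<le> n" for m n
      unfolding \<nu>_def by (rule someI_ex) (use seg[OF that] in blast)
    show "m \<le> n \<Longrightarrow> \<nu> m n \<in> Mor \<Lambda>" "m \<le> n \<Longrightarrow> src \<Lambda> (\<sigma> m) = rng \<Lambda> (\<nu> m n)"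
      "m \<le> n \<Longrightarrow> pcomp \<Lambda> (\<sigma> m) (\<nu> m n) = \<sigma> n" for m n
      using \<nu>[of m n] by simp_all
  qed
  have \<nu>_eq: "\<nu> m n = \<rho>" if "m \<le> n" "\<rho> \<in> Mor \<Lambda>" "src \<Lambda> (\<sigma> m) = rng \<Lambda> \<rho>" "pcomp \<Lambda> (\<sigma> m) \<rho> = \<sigma> n"
    for m n \<rho>
    by (rule comp_cancel(2)[of "\<sigma> m" "\<nu> m n" "\<sigma> m" \<rho>])
      (simp_all add: that \<sigma>\<nu> Mor \<nu>_Mor flip: src_\<sigma>)
  have \<nu>_src: "src \<Lambda> (\<nu> m n) = src \<Lambda> (\<sigma> n)" if "m \<le> n" for m n
    using src_comp[OF Mor \<nu>_Mor[OF that] src_\<sigma>[OF that]] by (simp add: \<sigma>\<nu> that)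
  have \<nu>_deg: "deg \<Lambda> (\<nu> m n) = n - m" if "m \<le> n" for m n
  proof -
    have "n = m + deg \<Lambda> (\<nu> m n)"
      using deg_comp[OF Mor \<nu>_Mor[OF that] src_\<sigma>[OF that]] by (simp add: \<sigma>\<nu> that deg)
    then show ?thesis by (metis nat_fun_add_diff_cancel)
  qed
  have \<nu>_refl: "\<nu> n n = src \<Lambda> (\<sigma> n)" for n
    using src_Obj[OF Mor, of n] Obj_subset by (intro \<nu>_eq) (auto simp: rng_id Mor comp_id_right)
  have \<nu>_comp: "\<nu> m p = pcomp \<Lambda> (\<nu> m n) (\<nu> n p)" if "m \<le> n" "n \<le> p" for m n p
  proof (rule \<nu>_eq)
    note M = \<nu>_Mor[OF that(1)] \<nu>_Mor[OF that(2)]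
    have s: "src \<Lambda> (\<nu> m n) = rng \<Lambda> (\<nu> n p)"
      using \<nu>_src[OF that(1)] src_\<sigma>[OF that(2)] by simp
    show "m \<le> p" using that by (rule order_trans)
    show "pcomp \<Lambda> (\<nu> m n) (\<nu> n p) \<in> Mor \<Lambda>"
      using M s by (rule comp_closed)
    show "src \<Lambda> (\<sigma> m) = rng \<Lambda> (pcomp \<Lambda> (\<nu> m n) (\<nu> n p))"
      unfolding rng_comp[OF M s] using that(1) by (rule src_\<sigma>)
    show "pcomp \<Lambda> (\<sigma> m) (pcomp \<Lambda> (\<nu> m n) (\<nu> n p)) = \<sigma> p"
      unfolding comp_assoc[OF Mor M src_\<sigma>[OF that(1)] s, symmetric] by (simp add: \<sigma>\<nu> that)
  qed
  \<comment> \<open>Both \<sigma> 0 and the range of \<sigma> n have degree 0, so \<sigma> n is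
    factored twice with a first factor of degree 0: once with remainder \<nu> 0 n, once with
    remainder \<sigma> n.\<close>
  have \<nu>_0: "\<nu> 0 n = \<sigma> n" for n
  proof (rule comp_cancel(2))
    have r: "rng \<Lambda> (\<sigma> n) \<in> Obj \<Lambda>"
      using Mor by (rule rng_Obj)
    then show "rng \<Lambda> (\<sigma> n) \<in> Mor \<Lambda>" "src \<Lambda> (rng \<Lambda> (\<sigma> n)) = rng \<Lambda> (\<sigma> n)"
      "deg \<Lambda> (\<sigma> 0) = deg \<Lambda> (rng \<Lambda> (\<sigma> n))"
      using Obj_subset by (auto simp: src_id deg deg_id)
    show "pcomp \<Lambda> (\<sigma> 0) (\<nu> 0 n) = pcomp \<Lambda> (rng \<Lambda> (\<sigma> n)) (\<sigma> n)"
      by (simp add: \<sigma>\<nu> comp_id_left Mor)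
  qed (simp_all add: Mor \<nu>_Mor src_\<sigma>)
  \<comment> \<open>The default \<open>undefined\<close> off the order is forced by the
    extensionality of functors.\<close>
  let ?x = "\<lambda>(m, n). if m \<le> n then \<nu> m n else undefined"
  have \<nu>_rng: "rng \<Lambda> (\<nu> m n) = \<nu> m m" if "m \<le> n" for m n
    unfolding \<nu>_refl using src_\<sigma>[OF that] by (rule sym)
  have "?x \<in> inf_paths \<Lambda>"
    unfolding inf_paths_iff
  proof (intro conjI allI impI)
    fix m n p :: "'k \<Rightarrow> nat"
    assume "m \<le> n" "n \<le> p"
    moreover from this have "m \<le> p" by (rule order_trans)
    ultimately show "?x (m, p) = pcomp \<Lambda> (?x (m, n)) (?x (n, p))"
      using \<nu>_comp[of m n p] by simp
  qed (simp_all add: \<nu>_Mor \<nu>_rng \<nu>_src \<nu>_refl \<nu>_deg)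
  moreover have "?x (0, n) = \<sigma> n" for n
    by (simp add: \<nu>_0)
  ultimately show ?thesis by blast
qed

section \<open>Tails and prefixed paths\<close>

lemma tail_inf_paths [simp]: "x \<in> inf_paths \<Lambda> \<Longrightarrow> tail x n \<in> inf_paths \<Lambda>"
  unfolding inf_paths_iff[of "tail x n"]
proof (intro conjI allI impI)
  fix m p q :: "'k \<Rightarrow> nat"
  assume x: "x \<in> inf_paths \<Lambda>" and "m \<le> p" "p \<le> q"
  moreover from this(2,3) have "m \<le> q" by (rule order_trans)
  ultimately show "tail x n (m, q) = pcomp \<Lambda> (tail x n (m, p)) (tail x n (p, q))"
    by (simp add: inf_path_comp add_left_mono)
qed (simp_all add: tail_undefined add_left_mono)

lemma tail_zero [simp]:
  assumes "x \<in> inf_paths \<Lambda>" shows "tail x 0 = x"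
proof
  fix a show "tail x 0 a = x a"
    using assms by (cases a; cases "fst a \<le> snd a") (auto simp: tail_undefined inf_path_undefined)
qed

text \<open>This gives meaning to the description operator in \<open>prepend\<close>. Existence
  assembles initial segments by \<open>inf_path_of_segments\<close>; uniqueness holds because the
  segments of degree d(\<eta>) + q are forced to be \<eta> y(0, q), and these are cofinal.\<close>

lemma ex1_prepend:
  assumes \<eta>: "\<eta> \<in> Mor \<Lambda>" and y: "y \<in> inf_paths \<Lambda>" and s: "y (0, 0) = src \<Lambda> \<eta>"
  shows "\<exists>!z. z \<in> inf_paths \<Lambda> \<and> z (0, deg \<Lambda> \<eta>) = \<eta> \<and> tail z (deg \<Lambda> \<eta>) = y"
proof (rule ex_ex1I)
  let ?d = "deg \<Lambda> \<eta>"
  have comp: "pcomp \<Lambda> \<eta> (y (0, q)) \<in> Mor \<Lambda>" "deg \<Lambda> (pcomp \<Lambda> \<eta> (y (0, q))) = ?d + q"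
    "src \<Lambda> (pcomp \<Lambda> \<eta> (y (0, q))) = y (q, q)" for q
    using \<eta> y s by (simp_all add: comp_closed deg_comp src_comp)
  txt \<open>The initial segment \<open>\<sigma> n\<close> of \<open>\<eta>y\<close> is cut from \<open>\<eta> y(0, n)\<close>, whose degree is at least \<open>n\<close>.\<close>
  have "\<exists>a b. a \<in> Mor \<Lambda> \<and> b \<in> Mor \<Lambda> \<and> src \<Lambda> a = rng \<Lambda> b \<and> deg \<Lambda> a = n \<and> deg \<Lambda> b = ?d \<and>
      pcomp \<Lambda> \<eta> (y (0, n)) = pcomp \<Lambda> a b" for n
    using ex1_implies_ex[OF unique_factorization[OF comp(1), of n n ?d]] comp(2)[of n]
    by (auto simp: add.commute)
  then obtain \<sigma> \<tau> where \<sigma>: "\<And>n. \<sigma> n \<in> Mor \<Lambda>" "\<And>n. deg \<Lambda> (\<sigma> n) = n"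
    and \<tau>: "\<And>n. \<tau> n \<in> Mor \<Lambda>" "\<And>n. src \<Lambda> (\<sigma> n) = rng \<Lambda> (\<tau> n)" "\<And>n. deg \<Lambda> (\<tau> n) = ?d"
    and \<sigma>\<tau>: "\<And>n. pcomp \<Lambda> \<eta> (y (0, n)) = pcomp \<Lambda> (\<sigma> n) (\<tau> n)"
    by metis
  have src_\<tau>: "src \<Lambda> (\<tau> n) = y (n, n)" for n
    using comp(3)[of n] \<sigma>\<tau>[of n] src_comp[OF \<sigma>(1) \<tau>(1) \<tau>(2)] by simp
  have ext: "pcomp \<Lambda> \<eta> (y (0, n)) = pcomp \<Lambda> (\<sigma> m) (pcomp \<Lambda> (\<tau> m) (y (m, n)))" if "m \<le> n" for m n
  proof -
    have "pcomp \<Lambda> \<eta> (y (0, n)) = pcomp \<Lambda> \<eta> (pcomp \<Lambda> (y (0, m)) (y (m, n)))"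
      using y that by (simp add: inf_path_comp)
    also have "\<dots> = pcomp \<Lambda> (pcomp \<Lambda> \<eta> (y (0, m))) (y (m, n))"
      using \<eta> y s that by (simp add: comp_assoc)
    also have "\<dots> = pcomp \<Lambda> (\<sigma> m) (pcomp \<Lambda> (\<tau> m) (y (m, n)))"
      unfolding \<sigma>\<tau> using y that by (simp add: comp_assoc \<sigma> \<tau> src_\<tau>)
    finally show ?thesis .
  qed
  \<comment> \<open>To see that \<sigma> n extends \<sigma> m, the path \<eta> y(0, n) is written as
    \<sigma> m followed by \<open>?\<rho>\<close>, and \<open>?\<rho>\<close> is cut at degree n -
    m. Its first part prolongs \<sigma> m to degree n, hence to \<sigma> n by cancellation.\<close>
  have "\<exists>\<nu> \<in> Mor \<Lambda>. src \<Lambda> (\<sigma> m) = rng \<Lambda> \<nu> \<and> \<sigma> n = pcomp \<Lambda> (\<sigma> m) \<nu>" if le: "m \<le> n" for m n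
  proof -
    let ?\<rho> = "pcomp \<Lambda> (\<tau> m) (y (m, n))"
    have \<rho>: "?\<rho> \<in> Mor \<Lambda>" "rng \<Lambda> ?\<rho> = rng \<Lambda> (\<tau> m)" "deg \<Lambda> ?\<rho> = (n - m) + ?d"
      using y le by (simp_all add: comp_closed rng_comp deg_comp \<tau> src_\<tau> add.commute)
    obtain a b where ab: "a \<in> Mor \<Lambda>" "b \<in> Mor \<Lambda>" "src \<Lambda> a = rng \<Lambda> b" "deg \<Lambda> a = n - m" "?\<rho> = pcomp \<Lambda> a b"
      using ex1_implies_ex[OF unique_factorization[OF \<rho>(1,3)]] by auto
    have ra: "src \<Lambda> (\<sigma> m) = rng \<Lambda> a"
      using \<rho>(2) ab rng_comp[OF ab(1-3)] \<tau>(2) by simp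
    have "pcomp \<Lambda> (\<sigma> n) (\<tau> n) = pcomp \<Lambda> (\<sigma> m) (pcomp \<Lambda> a b)"
      using ext[OF le] \<sigma>\<tau> ab(5) by simp
    also have "\<dots> = pcomp \<Lambda> (pcomp \<Lambda> (\<sigma> m) a) b"
      by (simp add: comp_assoc \<sigma> ab ra)
    finally have "pcomp \<Lambda> (\<sigma> n) (\<tau> n) = pcomp \<Lambda> (pcomp \<Lambda> (\<sigma> m) a) b" .
    moreover have "deg \<Lambda> (pcomp \<Lambda> (\<sigma> m) a) = n"
      using le by (simp add: deg_comp \<sigma> ab ra) (auto simp: nat_fun_le_iff)
    ultimately have "\<sigma> n = pcomp \<Lambda> (\<sigma> m) a"
      by (intro comp_cancel(1)[of "\<sigma> n" "\<tau> n" _ b]) (simp_all add: \<sigma> \<tau> ab comp_closed[OF \<sigma>(1) ab(1) ra] src_comp[OF \<sigma>(1) ab(1) ra])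
    then show ?thesis using ab(1) ra by blast
  qed
  from inf_path_of_segments[of \<sigma>, OF \<sigma> this] obtain z
    where z: "z \<in> inf_paths \<Lambda>" and z\<sigma>: "\<And>n. z (0, n) = \<sigma> n" by blast
  \<comment> \<open>With d = d(\<eta>), the path \<eta> y(0, d + q) has two factorizations whose
    first factor has degree d + q: the one through \<sigma> and \<tau>, and \<eta> y(0, q) followed
    by y(q, d + q).\<close>
  have z_init: "z (0, ?d + q) = pcomp \<Lambda> \<eta> (y (0, q))" for q
  proof -
    let ?c = "y (q, ?d + q)"
    have qd: "q \<le> ?d + q" by (simp add: le_fun_def)
    have "pcomp \<Lambda> (\<sigma> (?d + q)) (\<tau> (?d + q)) = pcomp \<Lambda> \<eta> (pcomp \<Lambda> (y (0, q)) ?c)"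
      using y qd by (simp add: \<sigma>\<tau>[symmetric] inf_path_comp)
    also have "\<dots> = pcomp \<Lambda> (pcomp \<Lambda> \<eta> (y (0, q))) ?c"
      using \<eta> y s qd by (simp add: comp_assoc)
    finally have "\<sigma> (?d + q) = pcomp \<Lambda> \<eta> (y (0, q))"
      using y qd comp by (intro comp_cancel(1)[OF \<sigma>(1) \<tau>(1,2), where d = ?c]) (simp_all add: \<sigma>)
    then show ?thesis by (simp add: z\<sigma>)
  qed
  have z\<eta>: "z (0, ?d) = \<eta>"
    using z_init[of 0] \<eta> s by (simp add: comp_id_right)
  have "tail z ?d = y"
  proof (rule inf_path_eqI[where N = 0])
    fix q
    have "z (?d, ?d + q) = y (0, q)"
    proof (rule comp_cancel(2))
      show "pcomp \<Lambda> (z (0, ?d)) (z (?d, ?d + q)) = pcomp \<Lambda> \<eta> (y (0, q))"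
        using z by (simp add: inf_path_comp z_init)
      have "src \<Lambda> \<eta> = z (?d, ?d)"
        using inf_path_src[OF z, of 0 ?d] z\<eta> by simp
      then show "src \<Lambda> (z (0, ?d)) = rng \<Lambda> (z (?d, ?d + q))"
        using z by simp
    qed (use z y \<eta> z\<eta> s in simp_all)
    then show "tail z ?d (0, 0 + q) = y (0, 0 + q)" by simp
  qed (use z y in simp_all)
  with z z\<eta> show "\<exists>z. z \<in> inf_paths \<Lambda> \<and> z (0, ?d) = \<eta> \<and> tail z ?d = y" by blast
next
  let ?d = "deg \<Lambda> \<eta>"
  fix z z'
  assume z: "z \<in> inf_paths \<Lambda> \<and> z (0, ?d) = \<eta> \<and> tail z ?d = y"
    and z': "z' \<in> inf_paths \<Lambda> \<and> z' (0, ?d) = \<eta> \<and> tail z' ?d = y"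
  have init: "w (0, ?d + q) = pcomp \<Lambda> \<eta> (y (0, q))"
    if w: "w \<in> inf_paths \<Lambda> \<and> w (0, ?d) = \<eta> \<and> tail w ?d = y" for w q
  proof -
    have "y (0, q) = w (?d, ?d + q)"
      using tail_apply[of 0 q w ?d] w by simp
    then show ?thesis
      using inf_path_comp[of w 0 ?d "?d + q"] w by simp
  qed
  show "z = z'"
    by (rule inf_path_eqI[where N = ?d]) (use z z' in \<open>simp_all only: init[OF z] init[OF z']\<close>)
qed

lemma
  assumes "\<eta> \<in> Mor \<Lambda>" "y \<in> inf_paths \<Lambda>" "y (0, 0) = src \<Lambda> \<eta>"
  shows prepend_inf_paths [simp]: "prepend \<Lambda> \<eta> y \<in> inf_paths \<Lambda>"
    and prepend_init [simp]: "prepend \<Lambda> \<eta> y (0, deg \<Lambda> \<eta>) = \<eta>"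
    and tail_prepend [simp]: "tail (prepend \<Lambda> \<eta> y) (deg \<Lambda> \<eta>) = y"
  using theI'[OF ex1_prepend[OF assms]] by (simp_all add: prepend_def)

text \<open>A path \<open>z\<close> with these properties forces \<eta> to be a morphism with source
  y(0, 0), so \<open>ex1_prepend\<close> applies. Later computations of \<open>prepend\<close> then
  only have to exhibit the right path.\<close>

lemma prepend_eqI:
  assumes "z \<in> inf_paths \<Lambda>" "z (0, deg \<Lambda> \<eta>) = \<eta>" "tail z (deg \<Lambda> \<eta>) = y"
  shows "prepend \<Lambda> \<eta> y = z"
proof -
  have "\<eta> \<in> Mor \<Lambda>" "src \<Lambda> \<eta> = z (deg \<Lambda> \<eta>, deg \<Lambda> \<eta>)"
    using inf_path_Mor[OF assms(1), of 0 "deg \<Lambda> \<eta>"] inf_path_src[OF assms(1), of 0 "deg \<Lambda> \<eta>"] assms(2)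
    by simp_all
  moreover have "y \<in> inf_paths \<Lambda>" "y (0, 0) = z (deg \<Lambda> \<eta>, deg \<Lambda> \<eta>)"
    using assms(1) by (simp_all flip: assms(3))
  ultimately show ?thesis
    unfolding prepend_def using assms by (intro the1_equality ex1_prepend) auto
qed

lemma prepend_rng [simp]:
  assumes "\<eta> \<in> Mor \<Lambda>" "y \<in> inf_paths \<Lambda>" "y (0, 0) = src \<Lambda> \<eta>"
  shows "prepend \<Lambda> \<eta> y (0, 0) = rng \<Lambda> \<eta>"
  using inf_path_rng[OF prepend_inf_paths[OF assms], of 0 "deg \<Lambda> \<eta>"] assms by simp

lemma prepend_id: "y \<in> inf_paths \<Lambda> \<Longrightarrow> y (0, 0) = v \<Longrightarrow> prepend \<Lambda> v y = y"
  by (intro prepend_eqI) (auto simp: deg_id)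

lemma prepend_prepend:
  assumes "\<eta> \<in> Mor \<Lambda>" "\<mu> \<in> Mor \<Lambda>" "src \<Lambda> \<eta> = rng \<Lambda> \<mu>" "y \<in> inf_paths \<Lambda>" "y (0, 0) = src \<Lambda> \<mu>"
  shows "prepend \<Lambda> \<eta> (prepend \<Lambda> \<mu> y) = prepend \<Lambda> (pcomp \<Lambda> \<eta> \<mu>) y"
proof (rule sym, rule prepend_eqI)
  let ?z = "prepend \<Lambda> \<eta> (prepend \<Lambda> \<mu> y)"
  have d: "deg \<Lambda> (pcomp \<Lambda> \<eta> \<mu>) = deg \<Lambda> \<eta> + deg \<Lambda> \<mu>"
    using assms by (simp add: deg_comp)
  show z: "?z \<in> inf_paths \<Lambda>" using assms by simp
  have "?z (deg \<Lambda> \<eta>, deg \<Lambda> \<eta> + deg \<Lambda> \<mu>) = tail ?z (deg \<Lambda> \<eta>) (0, deg \<Lambda> \<mu>)"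
    by (simp add: add.commute)
  also have "\<dots> = \<mu>" using assms by simp
  finally show "?z (0, deg \<Lambda> (pcomp \<Lambda> \<eta> \<mu>)) = pcomp \<Lambda> \<eta> \<mu>"
    using inf_path_comp[OF z, of 0 "deg \<Lambda> \<eta>" "deg \<Lambda> \<eta> + deg \<Lambda> \<mu>"] assms d by simp
  show "tail ?z (deg \<Lambda> (pcomp \<Lambda> \<eta> \<mu>)) = y"
    using assms by (simp add: d flip: tail_tail)
qed

text \<open>Cancellation at degree m. It is the reason why ghost paths compose in reverse order:
  removing the prefix \<eta> \<mu> amounts to removing \<eta> first and then \<mu>.\<close>

lemma inf_path_eq_pcomp_iff:
  assumes "\<eta> \<in> Mor \<Lambda>" "\<mu> \<in> Mor \<Lambda>" "src \<Lambda> \<eta> = rng \<Lambda> \<mu>" "y \<in> inf_paths \<Lambda>"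
    and "deg \<Lambda> \<eta> = m" "deg \<Lambda> \<mu> = n"
  shows "y (0, m + n) = pcomp \<Lambda> \<eta> \<mu> \<longleftrightarrow> y (0, m) = \<eta> \<and> y (m, m + n) = \<mu>"
proof -
  have eq: "pcomp \<Lambda> (y (0, m)) (y (m, m + n)) = y (0, m + n)"
    using assms(4) by (simp add: inf_path_comp)
  have s: "src \<Lambda> (y (0, m)) = rng \<Lambda> (y (m, m + n))" and d: "deg \<Lambda> (y (0, m)) = deg \<Lambda> \<eta>"
    using assms(4,5) by simp_all
  show ?thesis
  proof
    assume "y (0, m + n) = pcomp \<Lambda> \<eta> \<mu>"
    then show "y (0, m) = \<eta> \<and> y (m, m + n) = \<mu>"
      using comp_cancel[OF _ _ s assms(1-3) _ d] eq assms(1,4) by simp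
  qed (use eq in simp)
qed

section \<open>The action of the Kumjian--Pask algebra\<close>

lemma tail_class_inf_paths: "y \<in> tail_class \<Lambda> x \<Longrightarrow> y \<in> inf_paths \<Lambda>"
  by (simp add: tail_class_def)

lemma tail_equiv_tail: "tail_equiv x y \<Longrightarrow> tail_equiv x (tail y n)"
  unfolding tail_equiv_def by (metis add.commute tail_tail)

lemma tail_tail_class: "y \<in> tail_class \<Lambda> x \<Longrightarrow> tail y n \<in> tail_class \<Lambda> x"
  by (simp add: tail_class_def tail_equiv_tail)

lemma prepend_tail_class:
  assumes "y \<in> tail_class \<Lambda> x" "\<eta> \<in> Mor \<Lambda>" "y (0, 0) = src \<Lambda> \<eta>"
  shows "prepend \<Lambda> \<eta> y \<in> tail_class \<Lambda> x"
proof -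
  have y: "y \<in> inf_paths \<Lambda>" "tail_equiv x y"
    using assms(1) by (simp_all add: tail_class_def)
  have "tail_equiv y (prepend \<Lambda> \<eta> y)"
    unfolding tail_equiv_def
    using tail_prepend[OF assms(2) y(1) assms(3)] tail_zero[OF y(1)] by metis
  then show ?thesis
    using y assms(2,3) tail_equiv_trans by (auto simp: tail_class_def)
qed

lemma keys_gen_act_tail_class:
  assumes "g \<in> gens \<Lambda>" "y \<in> tail_class \<Lambda> x"
  shows "Poly_Mapping.keys (gen_act \<Lambda> g y :: _ \<Rightarrow>\<^sub>0 'K::field) \<subseteq> tail_class \<Lambda> x"
  using assms by (cases g) (auto simp: gens_def prepend_tail_class tail_tail_class)

lemma keys_free_act_tail_class:
  assumes "f \<in> free_nalg \<Lambda>" "Poly_Mapping.keys m \<subseteq> tail_class \<Lambda> x"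
  shows "Poly_Mapping.keys (free_act \<Lambda> f m) \<subseteq> tail_class \<Lambda> x"
  using assms keys_gen_act_tail_class by (rule keys_free_act)

lemma inf_path_init_rng:
  assumes "y \<in> inf_paths \<Lambda>" "y (0, n) = \<eta>" shows "y (0, 0) = rng \<Lambda> \<eta>"
  using inf_path_rng[OF assms(1), of 0 n] assms(2) by simp

lemma inf_path_init_src:
  assumes "y \<in> inf_paths \<Lambda>" "y (0, n) = \<eta>" shows "y (n, n) = src \<Lambda> \<eta>"
  using inf_path_src[OF assms(1), of 0 n] assms(2) by simp

lemma free_act_obj_single:
  assumes "v \<in> Obj \<Lambda>" "y \<in> inf_paths \<Lambda>"
  shows "free_act \<Lambda> (pth v) (Poly_Mapping.single y 1) =
    (if y (0, 0) = v then Poly_Mapping.single y 1 else 0)"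
  using assms by (simp add: free_act_pth_single src_id prepend_id)

text \<open>Such products span the graded components, and each replaces the prefix \<mu> by \<eta>.
  Equality of the sources ensures that the tail left after \<mu> can be prefixed with \<eta>, so a
  single condition remains.\<close>

lemma free_act_pth_gho_single:
  assumes "src \<Lambda> \<eta> = src \<Lambda> \<mu>" "y \<in> inf_paths \<Lambda>"
  shows "free_act \<Lambda> (pth \<eta> * gho \<mu>) (Poly_Mapping.single y 1) =
    (if y (0, deg \<Lambda> \<mu>) = \<mu> then Poly_Mapping.single (prepend \<Lambda> \<eta> (tail y (deg \<Lambda> \<mu>))) 1 else 0)"
proof (cases "y (0, deg \<Lambda> \<mu>) = \<mu>")
  case True
  then have "y (deg \<Lambda> \<mu>, deg \<Lambda> \<mu>) = src \<Lambda> \<eta>"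
    using inf_path_init_src assms by simp
  then show ?thesis
    using True by (simp add: free_act_times free_act_gho_single free_act_pth_single)
qed (simp add: free_act_times free_act_gho_single free_act_zero_right)

lemma prepend_init_tail: "y \<in> inf_paths \<Lambda> \<Longrightarrow> prepend \<Lambda> (y (0, n)) (tail y n) = y"
  by (rule prepend_eqI) simp_all

text \<open>Each relation becomes a statement about adding and removing prefixes of one path: (KP2)
  is the associativity of these operations, (KP3) says that a prefix of given degree is unique, and
  (KP4) that every path has a prefix of each degree.\<close>

lemma free_act_kp_rel:
  fixes f g :: "('p, 'K::field) free_alg"
  assumes fin: "row_finite \<Lambda>" and fg: "kp_rel \<Lambda> f g" and y: "y \<in> inf_paths \<Lambda>"
  shows "free_act \<Lambda> f (Poly_Mapping.single y 1) = free_act \<Lambda> g (Poly_Mapping.single y 1)"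
  using fg
proof cases
  case (KP1_idem v w)
  then show ?thesis
    using y by (simp add: free_act_times free_act_obj_single free_act_zero_right free_act_zero_left)
next
  case (KP1_star v)
  then show ?thesis
    using y by (simp add: free_act_obj_single free_act_gho_single deg_id)
next
  case (KP2_path \<eta> \<mu>)
  then show ?thesis
    using y by (cases "y (0, 0) = src \<Lambda> \<mu>")
      (simp_all add: free_act_times free_act_pth_single free_act_zero_right src_comp prepend_prepend)
next
  case (KP2_ghost \<eta> \<mu>)
  have d: "deg \<Lambda> (pcomp \<Lambda> \<eta> \<mu>) = deg \<Lambda> \<eta> + deg \<Lambda> \<mu>"
    using KP2_ghost by (simp add: deg_comp)
  have iff: "y (0, deg \<Lambda> \<eta> + deg \<Lambda> \<mu>) = pcomp \<Lambda> \<eta> \<mu> \<longleftrightarrow>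
      y (0, deg \<Lambda> \<eta>) = \<eta> \<and> y (deg \<Lambda> \<eta>, deg \<Lambda> \<eta> + deg \<Lambda> \<mu>) = \<mu>"
    using KP2_ghost y by (intro inf_path_eq_pcomp_iff) simp_all
  show ?thesis
    unfolding KP2_ghost(1,2) free_act_times free_act_gho_single d iff
    by (cases "y (0, deg \<Lambda> \<eta>) = \<eta>") (simp_all add: free_act_zero_right free_act_gho_single tail_tail)
next
  case (KP2_rng_path \<eta>)
  then show ?thesis
    using y rng_Obj[of \<eta>] by (cases "y (0, 0) = src \<Lambda> \<eta>")
      (simp_all add: free_act_times free_act_pth_single[of _ \<eta>] free_act_zero_right free_act_obj_single)
next
  case (KP2_path_src \<eta>)
  then show ?thesis
    using y src_Obj[of \<eta>] by (cases "y (0, 0) = src \<Lambda> \<eta>")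
      (simp_all add: free_act_times free_act_pth_single[of _ \<eta>] free_act_zero_right free_act_obj_single)
next
  case (KP2_src_ghost \<eta>)
  show ?thesis
  proof (cases "y (0, deg \<Lambda> \<eta>) = \<eta>")
    case True
    then show ?thesis
      using inf_path_init_src[OF y True] src_Obj[OF KP2_src_ghost(3)] y
      by (simp add: KP2_src_ghost(1,2) free_act_times free_act_gho_single free_act_obj_single)
  qed (simp add: KP2_src_ghost(1,2) free_act_times free_act_gho_single free_act_zero_right)
next
  case (KP2_ghost_rng \<eta>)
  have r: "rng \<Lambda> \<eta> \<in> Obj \<Lambda>"
    using KP2_ghost_rng(3) by (rule rng_Obj)
  show ?thesis
  proof (cases "y (0, 0) = rng \<Lambda> \<eta>")
    case True
    then show ?thesis
      using y r by (simp add: KP2_ghost_rng(1,2) free_act_times free_act_obj_single)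
  next
    case False
    then have "y (0, deg \<Lambda> \<eta>) \<noteq> \<eta>"
      using inf_path_init_rng[OF y] by blast
    then show ?thesis
      using False y r
      by (simp add: KP2_ghost_rng(1,2) free_act_times free_act_obj_single free_act_gho_single free_act_zero_right)
  qed
next
  case (KP3 \<eta> \<mu>)
  show ?thesis
  proof (cases "y (0, 0) = src \<Lambda> \<mu>")
    case True
    have "src \<Lambda> \<mu> \<in> Obj \<Lambda>"
      using KP3(4) by (rule src_Obj)
    \<comment> \<open>The prefix of degree d(\<eta>) = d(\<mu>) of the path \<mu> y is \<mu>, so the
      ghost path of \<eta> returns \<open>y\<close> exactly when \<eta> = \<mu>.\<close>
    moreover have "free_act \<Lambda> f (Poly_Mapping.single y 1) =
        (if \<mu> = \<eta> then Poly_Mapping.single y (1 :: 'K) else 0)"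
      unfolding KP3(1) free_act_times free_act_pth_single
      using prepend_init[OF KP3(4) y True] tail_prepend[OF KP3(4) y True]
      by (simp only: True if_True simp_thms free_act_gho_single KP3(5))
    ultimately show ?thesis
      unfolding KP3(2) using y True
      by (cases "\<mu> = \<eta>") (simp_all add: free_act_obj_single free_act_zero_left)
  next
    case False
    have "src \<Lambda> \<eta> \<in> Obj \<Lambda>"
      using KP3(3) by (rule src_Obj)
    then show ?thesis
      unfolding KP3(1,2) free_act_times free_act_pth_single[of _ \<mu>] using False y
      by (cases "\<eta> = \<mu>") (simp_all add: free_act_obj_single free_act_zero_left free_act_zero_right)
  qed
next
  case (KP4 v n)
  \<comment> \<open>Row-finiteness enters here: a sum over an infinite set is 0 in HOL. In the
    finite sum only the term of y(0, n) survives, and this term occurs exactly when y(0, 0) =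
    v.\<close>
  have "finite (paths_from \<Lambda> v n)"
    using fin KP4(3) by (simp add: row_finite_def)
  moreover have "free_act \<Lambda> (pth \<eta> * gho \<eta> :: ('p, 'K) free_alg) (Poly_Mapping.single y 1) =
      (if \<eta> = y (0, n) then Poly_Mapping.single y 1 else 0)" if "\<eta> \<in> paths_from \<Lambda> v n" for \<eta>
  proof -
    have "deg \<Lambda> \<eta> = n" using that by (simp add: paths_from_def)
    then show ?thesis
      using free_act_pth_gho_single[OF refl y, of \<eta>] prepend_init_tail[OF y, of n] by auto
  qed
  moreover have "y (0, n) \<in> paths_from \<Lambda> v n \<longleftrightarrow> y (0, 0) = v"
    using y by (simp add: paths_from_def)
  ultimately show ?thesis
    unfolding KP4(1,2) using KP4(3) y by (simp add: free_act_obj_single free_act_sum_left cong: sum.cong)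
qed

text \<open>Induction over the generation of the ideal. The vector \<open>m\<close> is kept
  arbitrary because in the case f * h the factor \<open>f\<close> acts on the image of
  \<open>m\<close> under \<open>h\<close>; that image stays in the span of the class as
  \<open>h\<close> lies in the free algebra on \<open>gens \<Lambda>\<close>.\<close>

lemma free_act_kp_ideal:
  assumes fin: "row_finite \<Lambda>" and f: "f \<in> kp_ideal \<Lambda>"
    and m: "Poly_Mapping.keys m \<subseteq> tail_class \<Lambda> x"
  shows "free_act \<Lambda> f m = 0"
  using f m
proof (induction arbitrary: m)
  case (rel f g)
  have "free_act \<Lambda> f m = free_act \<Lambda> g m"
    by (rule module_hom_eq_on_singles[OF module_hom_free_act module_hom_free_act _ rel.prems])
      (rule free_act_kp_rel[OF fin rel.hyps tail_class_inf_paths])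
  then show ?case by (simp add: free_act_diff_left)
next
  case (mult_right f h)
  then show ?case
    by (simp add: free_act_times keys_free_act_tail_class)
qed (simp_all add: free_act_zero_left free_act_add_left free_act_scale_left free_act_times free_act_zero_right)

end

section \<open>The quotient algebra and the module structure of K[x]\<close>

lemma kp_ideal_uminus: "f \<in> kp_ideal \<Lambda> \<Longrightarrow> - f \<in> kp_ideal \<Lambda>"
  using kp_ideal.scale[of f \<Lambda> "-1"] by simp

lemma free_nalg_plus:
  assumes "f \<in> free_nalg \<Lambda>" "g \<in> free_nalg \<Lambda>" shows "f + g \<in> free_nalg \<Lambda>"
  using assms Poly_Mapping.keys_add[of f g] by (auto simp: free_nalg_def)

lemma free_nalg_scale:
  assumes "f \<in> free_nalg \<Lambda>" shows "pm_scale c f \<in> free_nalg \<Lambda>"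
  using assms keys_pm_scale_subset[of c f] by (auto simp: free_nalg_def)

lemma free_nalg_times:
  assumes "f \<in> free_nalg \<Lambda>" "g \<in> free_nalg \<Lambda>" shows "f * g \<in> free_nalg \<Lambda>"
  using assms Poly_Mapping.keys_mult[of f g] by (fastforce simp: free_nalg_def plus_fword_def)

lemma pth_free_nalg: "\<eta> \<in> Mor \<Lambda> \<Longrightarrow> pth \<eta> \<in> free_nalg \<Lambda>"
  and gho_free_nalg: "\<eta> \<in> Mor \<Lambda> \<Longrightarrow> gho \<eta> \<in> free_nalg \<Lambda>"
  by (simp_all add: free_nalg_def pth_def gho_def gens_def)

lemma equiv_kp_cong: "equiv (free_nalg \<Lambda>) (kp_cong \<Lambda> :: ('p, 'K::field) free_alg rel)"
proof (rule equivI)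
  show "kp_cong \<Lambda> \<subseteq> free_nalg \<Lambda> \<times> free_nalg \<Lambda>"
    by (auto simp: kp_cong_def)
  show "refl_on (free_nalg \<Lambda>) (kp_cong \<Lambda> :: ('p, 'K) free_alg rel)"
    by (auto simp: refl_on_def kp_cong_def kp_ideal.zero)
  show "sym (kp_cong \<Lambda> :: ('p, 'K) free_alg rel)"
    unfolding sym_def kp_cong_def using kp_ideal_uminus by fastforce
  show "trans (kp_cong \<Lambda> :: ('p, 'K) free_alg rel)"
  proof (rule transI)
    fix f g h :: "('p, 'K) free_alg"
    assume "(f, g) \<in> kp_cong \<Lambda>" "(g, h) \<in> kp_cong \<Lambda>"
    then show "(f, h) \<in> kp_cong \<Lambda>"
      using kp_ideal.add[of "f - g" \<Lambda> "g - h"] by (simp add: kp_cong_def)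
  qed
qed

abbreviation kp_class :: "('p, 'k) kgraph \<Rightarrow> ('p, 'K::field) free_alg \<Rightarrow> ('p, 'K) kp_elem" where
  "kp_class \<Lambda> f \<equiv> kp_cong \<Lambda> `` {f}"

lemma acarrier_KP: "acarrier (KP \<Lambda>) = kp_class \<Lambda> ` free_nalg \<Lambda>"
  by (auto simp: KP_def quotient_def)

lemma aadd_KP:
  fixes f g :: "('p, 'K::field) free_alg"
  assumes "f \<in> free_nalg \<Lambda>" "g \<in> free_nalg \<Lambda>"
  shows "aadd (KP \<Lambda>) (kp_class \<Lambda> f) (kp_class \<Lambda> g) = kp_class \<Lambda> (f + g)"
proof -
  have "congruent2 (kp_cong \<Lambda>) (kp_cong \<Lambda>) (\<lambda>f g :: ('p, 'K) free_alg. kp_class \<Lambda> (f + g))"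
  proof (rule congruent2I', rule equiv_class_eq[OF equiv_kp_cong])
    fix f f' g g' :: "('p, 'K) free_alg"
    assume "(f, f') \<in> kp_cong \<Lambda>" "(g, g') \<in> kp_cong \<Lambda>"
    then show "(f + g, f' + g') \<in> kp_cong \<Lambda>"
      using kp_ideal.add[of "f - f'" \<Lambda> "g - g'"]
      by (simp add: kp_cong_def free_nalg_plus algebra_simps)
  qed
  from UN_equiv_class2[OF equiv_kp_cong equiv_kp_cong this assms] show ?thesis
    by (simp add: KP_def)
qed

lemma amult_KP:
  fixes f g :: "('p, 'K::field) free_alg"
  assumes "f \<in> free_nalg \<Lambda>" "g \<in> free_nalg \<Lambda>"
  shows "amult (KP \<Lambda>) (kp_class \<Lambda> f) (kp_class \<Lambda> g) = kp_class \<Lambda> (f * g)"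
proof -
  have "congruent2 (kp_cong \<Lambda>) (kp_cong \<Lambda>) (\<lambda>f g :: ('p, 'K) free_alg. kp_class \<Lambda> (f * g))"
  proof (rule congruent2I', rule equiv_class_eq[OF equiv_kp_cong])
    fix f f' g g' :: "('p, 'K) free_alg"
    assume fg: "(f, f') \<in> kp_cong \<Lambda>" "(g, g') \<in> kp_cong \<Lambda>"
    \<comment> \<open>The sum telescopes to f * g - f' * g', and each summand has one factor in the
      ideal and one in the free algebra.\<close>
    have "(f - f') * g + f' * (g - g') \<in> kp_ideal \<Lambda>"
      using fg by (intro kp_ideal.add kp_ideal.mult_left kp_ideal.mult_right) (auto simp: kp_cong_def)
    then show "(f * g, f' * g') \<in> kp_cong \<Lambda>"
      using fg by (simp add: kp_cong_def free_nalg_times algebra_simps)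
  qed
  from UN_equiv_class2[OF equiv_kp_cong equiv_kp_cong this assms] show ?thesis
    by (simp add: KP_def)
qed

lemma ascale_KP:
  fixes f :: "('p, 'K::field) free_alg"
  assumes "f \<in> free_nalg \<Lambda>"
  shows "ascale (KP \<Lambda>) c (kp_class \<Lambda> f) = kp_class \<Lambda> (pm_scale c f)"
proof -
  have "congruent (kp_cong \<Lambda>) (\<lambda>f :: ('p, 'K) free_alg. kp_class \<Lambda> (pm_scale c f))"
  proof (rule congruentI, rule equiv_class_eq[OF equiv_kp_cong])
    fix f f' :: "('p, 'K) free_alg"
    assume "(f, f') \<in> kp_cong \<Lambda>"
    then show "(pm_scale c f, pm_scale c f') \<in> kp_cong \<Lambda>"
      using kp_ideal.scale[of "f - f'" \<Lambda> c]
      by (simp add: kp_cong_def free_nalg_scale pm.scale_right_diff_distrib)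
  qed
  from UN_equiv_class[OF equiv_kp_cong this assms] show ?thesis
    by (simp add: KP_def)
qed

lemma path_module_simps [simp]:
  "mcarrier (path_module \<Lambda> x) = {m. Poly_Mapping.keys m \<subseteq> tail_class \<Lambda> x}"
  "mscale (path_module \<Lambda> x) = pm_scale"
  "mact (path_module \<Lambda> x) = kp_act \<Lambda>"
  by (simp_all add: path_module_def)

context k_graph
begin

text \<open>Two representatives differ by an element of the ideal, which kills K[x], so the
  description operator in \<open>kp_act\<close> picks a genuine value. From here on the action is
  computed with representatives.\<close>

lemma kp_act_class:
  assumes fin: "row_finite \<Lambda>" and f: "f \<in> free_nalg \<Lambda>"
    and m: "Poly_Mapping.keys m \<subseteq> tail_class \<Lambda> x"
  shows "kp_act \<Lambda> (kp_class \<Lambda> f) m = free_act \<Lambda> f m"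
  unfolding kp_act_def
proof (rule the_equality)
  show "\<forall>g \<in> kp_class \<Lambda> f. free_act \<Lambda> g m = free_act \<Lambda> f m"
  proof
    fix g assume "g \<in> kp_class \<Lambda> f"
    then have "f - g \<in> kp_ideal \<Lambda>" by (simp add: kp_cong_def)
    from free_act_kp_ideal[OF fin this m] show "free_act \<Lambda> g m = free_act \<Lambda> f m"
      by (simp add: free_act_diff_left)
  qed
  fix u
  assume "\<forall>g \<in> kp_class \<Lambda> f. free_act \<Lambda> g m = u"
  from bspec[OF this equiv_class_self[OF equiv_kp_cong f]] show "u = free_act \<Lambda> f m"
    by (rule sym)
qed

lemma left_module_path_module:
  assumes "row_finite \<Lambda>"
  shows "left_module (KP \<Lambda>) (path_module \<Lambda> x :: ('p, 'k, 'K::field) path_module)"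
proof -
  let ?S = "{m :: ('p, 'k) ipath \<Rightarrow>\<^sub>0 'K. Poly_Mapping.keys m \<subseteq> tail_class \<Lambda> x}"
  note act = kp_act_class[OF assms, where x = x]
  have add: "m + n \<in> ?S" if "m \<in> ?S" "n \<in> ?S" for m n
    using subspace_keys_subset that by (rule pm.subspace_add)
  have scale: "pm_scale c m \<in> ?S" if "m \<in> ?S" for c m
    using subspace_keys_subset that by (rule pm.subspace_scale)
  show ?thesis
    unfolding left_module_def acarrier_KP path_module_simps
  proof (intro conjI allI impI; (elim imageE)?; (simp only:)?)
    show "vector_space (pm_scale :: 'K \<Rightarrow> (('p, 'k) ipath \<Rightarrow>\<^sub>0 'K) \<Rightarrow> _)"
      by (rule pm.vector_space_axioms)
    show "pm.subspace ?S"
      by (rule subspace_keys_subset)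
    fix f g :: "('p, 'K) free_alg" and c :: 'K and m n :: "('p, 'k) ipath \<Rightarrow>\<^sub>0 'K"
    assume f: "f \<in> free_nalg \<Lambda>" and m: "m \<in> ?S"
    then show "kp_act \<Lambda> (kp_class \<Lambda> f) m \<in> ?S"
      by (simp add: act keys_free_act_tail_class)
    show "kp_act \<Lambda> (ascale (KP \<Lambda>) c (kp_class \<Lambda> f)) m = pm_scale c (kp_act \<Lambda> (kp_class \<Lambda> f) m)"
      using f m by (simp add: ascale_KP act free_nalg_scale free_act_scale_left)
    show "kp_act \<Lambda> (kp_class \<Lambda> f) (pm_scale c m) = pm_scale c (kp_act \<Lambda> (kp_class \<Lambda> f) m)"
      using f m scale[OF m] by (simp add: act free_act_scale_right)
    show "kp_act \<Lambda> (kp_class \<Lambda> f) (m + n) = kp_act \<Lambda> (kp_class \<Lambda> f) m + kp_act \<Lambda> (kp_class \<Lambda> f) n"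
      if "n \<in> ?S"
      using f m that add[OF m that] by (simp add: act free_act_add_right)
    assume g: "g \<in> free_nalg \<Lambda>"
    show "kp_act \<Lambda> (aadd (KP \<Lambda>) (kp_class \<Lambda> f) (kp_class \<Lambda> g)) m =
        kp_act \<Lambda> (kp_class \<Lambda> f) m + kp_act \<Lambda> (kp_class \<Lambda> g) m"
      using f g m by (simp add: aadd_KP act free_nalg_plus free_act_add_left)
    show "kp_act \<Lambda> (amult (KP \<Lambda>) (kp_class \<Lambda> f) (kp_class \<Lambda> g)) m =
        kp_act \<Lambda> (kp_class \<Lambda> f) (kp_act \<Lambda> (kp_class \<Lambda> g) m)"
      using f g m by (simp add: amult_KP act free_nalg_times free_act_times keys_free_act_tail_class)
  qed
qed

section \<open>Simplicity and isomorphism classes\<close>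

lemma free_act_gho_init_single:
  assumes "y \<in> inf_paths \<Lambda>" "z \<in> inf_paths \<Lambda>"
  shows "free_act \<Lambda> (gho (y (0, n))) (Poly_Mapping.single z 1) =
    (if z (0, n) = y (0, n) then Poly_Mapping.single (tail z n) 1 else 0)"
  using assms by (simp add: free_act_gho_single)

lemma free_act_pth_init_single:
  assumes "y \<in> inf_paths \<Lambda>"
  shows "free_act \<Lambda> (pth (y (0, n))) (Poly_Mapping.single (tail y n) 1) = Poly_Mapping.single y 1"
  using assms by (simp add: free_act_pth_single prepend_init_tail)

text \<open>Every path of \<open>F\<close> other than \<open>y\<close> differs from \<open>y\<close>
  at some degree, and longer segments still differ. The sum of these degrees separates all of
  \<open>F\<close> at once.\<close>

lemma separate_inf_paths:
  assumes "finite F" "F \<subseteq> inf_paths \<Lambda>" "y \<in> inf_paths \<Lambda>"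
  shows "\<exists>n. \<forall>z \<in> F. z (0, n) = y (0, n) \<longrightarrow> z = y"
  using assms(1,2)
proof (induction F)
  case (insert z F)
  from insert.IH obtain n where n: "\<forall>w \<in> F. w (0, n) = y (0, n) \<longrightarrow> w = y"
    using insert.prems by blast
  have "\<exists>n'. z (0, n') = y (0, n') \<longrightarrow> z = y"
    using inf_path_eqI[of z y 0] insert.prems assms(3) by (metis insert_subset)
  then obtain n' where n': "z (0, n') = y (0, n') \<Longrightarrow> z = y"
    by blast
  have "w = y" if w: "w \<in> insert z F" "w (0, n + n') = y (0, n + n')" for w
  proof -
    have "w \<in> inf_paths \<Lambda>" using w insert.prems by blast
    then have "w (0, n) = y (0, n)" "w (0, n') = y (0, n')"
      using inf_path_init_mono[of w y _ "n + n'"] w(2) assms(3) by (simp_all add: le_fun_def)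
    then show ?thesis using n n' w(1) by blast
  qed
  then show ?case by blast
qed simp

lemma free_act_expand:
  "free_act \<Lambda> f m = (\<Sum>y \<in> Poly_Mapping.keys m.
     pm_scale (Poly_Mapping.lookup m y) (free_act \<Lambda> f (Poly_Mapping.single y 1)))"
proof -
  have "free_act \<Lambda> f (\<Sum>y \<in> Poly_Mapping.keys m.
      pm_scale (Poly_Mapping.lookup m y) (Poly_Mapping.single y 1)) = (\<Sum>y \<in> Poly_Mapping.keys m.
     pm_scale (Poly_Mapping.lookup m y) (free_act \<Lambda> f (Poly_Mapping.single y 1)))"
    by (simp only: free_act_sum_right free_act_scale_right)
  then show ?thesis by (simp add: pm_scale_single poly_mapping_sum_single)
qed

text \<open>Only basis vectors starting with y(0, n) survive the ghost path, and separation leaves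
  at most \<open>y\<close> among them. Simplicity uses this with \<open>y\<close> in the support of
  \<open>m\<close>, the distinction of modules with \<open>y\<close> outside it, where the
  coefficient is 0.\<close>

lemma free_act_gho_init_separating:
  fixes m :: "('p, 'k) ipath \<Rightarrow>\<^sub>0 'K::field"
  assumes y: "y \<in> inf_paths \<Lambda>" and m: "Poly_Mapping.keys m \<subseteq> inf_paths \<Lambda>"
    and sep: "\<And>z. z \<in> Poly_Mapping.keys m \<Longrightarrow> z (0, n) = y (0, n) \<Longrightarrow> z = y"
  shows "free_act \<Lambda> (gho (y (0, n))) m =
    pm_scale (Poly_Mapping.lookup m y) (Poly_Mapping.single (tail y n) 1)"
proof -
  have "free_act \<Lambda> (gho (y (0, n))) (Poly_Mapping.single z (1 :: 'K)) =
      (if z = y then Poly_Mapping.single (tail y n) 1 else 0)" if "z \<in> Poly_Mapping.keys m" for z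
    using sep[OF that] that m by (auto simp: free_act_gho_init_single y subset_iff)
  then have "free_act \<Lambda> (gho (y (0, n))) m = (\<Sum>z \<in> Poly_Mapping.keys m.
      if z = y then pm_scale (Poly_Mapping.lookup m y) (Poly_Mapping.single (tail y n) 1) else 0)"
    unfolding free_act_expand[of _ m] by (intro sum.cong) simp_all
  then show ?thesis
    by (simp add: in_keys_iff)
qed

lemma in_tail_class_self: "x \<in> inf_paths \<Lambda> \<Longrightarrow> x \<in> tail_class \<Lambda> x"
  by (simp add: tail_class_def tail_equiv_refl)

lemma single_in_tail_class:
  "x \<in> inf_paths \<Lambda> \<Longrightarrow> Poly_Mapping.keys (Poly_Mapping.single x c) \<subseteq> tail_class \<Lambda> x"
  by (simp add: in_tail_class_self)

lemma simple_path_module: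
  assumes fin: "row_finite \<Lambda>" and x: "x \<in> inf_paths \<Lambda>"
  shows "simple_module (KP \<Lambda>) (path_module \<Lambda> x :: ('p, 'k, 'K::field) path_module)"
  unfolding simple_module_def
proof (intro conjI allI impI)
  let ?M = "path_module \<Lambda> x :: ('p, 'k, 'K) path_module"
  show "left_module (KP \<Lambda>) ?M"
    using fin by (rule left_module_path_module)
  let ?v = "pth (x (0, 0)) :: ('p, 'K) free_alg" and ?x = "Poly_Mapping.single x (1 :: 'K)"
  have v: "?v \<in> free_nalg \<Lambda>"
    using x by (simp add: pth_free_nalg)
  \<comment> \<open>The vertex x(0, 0) fixes the basis vector \<open>x\<close>, so the algebra does
    not act by zero.\<close>
  have "kp_act \<Lambda> (kp_class \<Lambda> ?v) ?x = ?x"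
    unfolding kp_act_class[OF fin v single_in_tail_class[OF x]]
    using x by (simp add: free_act_obj_single)
  moreover have "?x \<noteq> 0"
    by (metis lookup_single_eq lookup_zero zero_neq_one)
  ultimately show "\<exists>a \<in> acarrier (KP \<Lambda>). \<exists>m \<in> mcarrier ?M. mact ?M a m \<noteq> 0"
    unfolding acarrier_KP path_module_simps
    by (intro bexI[of _ "kp_class \<Lambda> ?v"] bexI[of _ ?x])
      (use v in_tail_class_self[OF x] in simp_all)
  fix N
  assume "is_submodule (KP \<Lambda>) ?M N"
  then have N: "\<And>m. m \<in> N \<Longrightarrow> Poly_Mapping.keys m \<subseteq> tail_class \<Lambda> x" "pm.subspace N"
    and act: "\<And>a m. a \<in> acarrier (KP \<Lambda>) \<Longrightarrow> m \<in> N \<Longrightarrow> kp_act \<Lambda> a m \<in> N"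
    by (auto simp: is_submodule_def)
  have N_act: "free_act \<Lambda> f m \<in> N" if "f \<in> free_nalg \<Lambda>" "m \<in> N" for f m
    using act[of "kp_class \<Lambda> f" m] kp_act_class[OF fin that(1) N(1)[OF that(2)]] that
    by (simp add: acarrier_KP)
  show "N = {0} \<or> N = mcarrier ?M"
  proof (cases "N = {0}")
    case False
    then obtain m where m: "m \<in> N" "m \<noteq> 0"
      using pm.subspace_0[OF N(2)] by blast
    then obtain y where y_key: "y \<in> Poly_Mapping.keys m"
      by (metis ex_in_conv poly_mapping_eqI in_keys_iff lookup_zero)
    then have y: "y \<in> inf_paths \<Lambda>" "tail_equiv x y"
      using N(1)[OF m(1)] by (auto simp: tail_class_def)
    have keys: "Poly_Mapping.keys m \<subseteq> inf_paths \<Lambda>"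
      using N(1)[OF m(1)] by (auto simp: tail_class_def)
    obtain n where n: "\<And>z. z \<in> Poly_Mapping.keys m \<Longrightarrow> z (0, n) = y (0, n) \<Longrightarrow> z = y"
      using separate_inf_paths[OF finite_keys keys y(1)] by blast
    have "pm_scale (Poly_Mapping.lookup m y) (Poly_Mapping.single (tail y n) 1) \<in> N"
      using N_act[OF gho_free_nalg m(1), of "y (0, n)"] y(1)
      by (simp add: free_act_gho_init_separating[OF y(1) keys n])
    from pm.subspace_scale[OF N(2) this, of "inverse (Poly_Mapping.lookup m y)"]
    have tail_N: "Poly_Mapping.single (tail y n) 1 \<in> N"
      using y_key by (simp add: in_keys_iff)
    have "Poly_Mapping.single z 1 \<in> N" if "z \<in> tail_class \<Lambda> x" for z
    proof -
      have z: "z \<in> inf_paths \<Lambda>" "tail_equiv z y"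
        using that y by (auto simp: tail_class_def intro: tail_equiv_sym tail_equiv_trans)
      then obtain p q where pq: "tail z p = tail y q"
        by (auto simp: tail_equiv_def)
      \<comment> \<open>Removing a further segment of degree q reaches a common tail: shifting
        \<open>pq\<close> by n identifies it as the tail of \<open>z\<close> at p + n. Prefixing
        z(0, p + n) then gives \<open>z\<close>.\<close>
      have "free_act \<Lambda> (gho (tail y n (0, q))) (Poly_Mapping.single (tail y n) 1) \<in> N"
        using y(1) tail_N by (intro N_act gho_free_nalg) simp_all
      then have "Poly_Mapping.single (tail y (n + q)) 1 \<in> N"
        using y(1) by (simp only: free_act_gho_init_single tail_inf_paths refl if_True tail_tail)
      moreover have "tail y (n + q) = tail z (p + n)"
        by (metis add.commute pq tail_tail)
      ultimately have "free_act \<Lambda> (pth (z (0, p + n))) (Poly_Mapping.single (tail z (p + n)) 1) \<in> N"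
        using z(1) by (intro N_act pth_free_nalg) simp_all
      then show ?thesis
        using z(1) by (simp only: free_act_pth_init_single)
    qed
    then have "m \<in> N" if "Poly_Mapping.keys m \<subseteq> tail_class \<Lambda> x" for m
    proof -
      have "(\<Sum>z \<in> Poly_Mapping.keys m. pm_scale (Poly_Mapping.lookup m z) (Poly_Mapping.single z 1)) \<in> N"
        using \<open>\<And>z. z \<in> tail_class \<Lambda> x \<Longrightarrow> Poly_Mapping.single z 1 \<in> N\<close> that
        by (intro pm.subspace_sum[OF N(2)] pm.subspace_scale[OF N(2)]) blast
      then show ?thesis
        by (simp add: pm_scale_single poly_mapping_sum_single)
    qed
    then show ?thesis using N(1) by auto
  qed simp
qed

lemma path_module_isomorphic_iff:
  assumes fin: "row_finite \<Lambda>" and x: "x \<in> inf_paths \<Lambda>" and y: "y \<in> inf_paths \<Lambda>"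
  shows "module_isomorphic (KP \<Lambda>) (path_module \<Lambda> x :: ('p, 'k, 'K::field) path_module)
    (path_module \<Lambda> y :: ('p, 'k, 'K) path_module) \<longleftrightarrow> tail_equiv x y"
proof
  assume "tail_equiv x y"
  then have "tail_class \<Lambda> x = tail_class \<Lambda> y"
    by (rule tail_class_cong)
  then show "module_isomorphic (KP \<Lambda>) (path_module \<Lambda> x :: ('p, 'k, 'K) path_module)
      (path_module \<Lambda> y :: ('p, 'k, 'K) path_module)"
    unfolding module_isomorphic_def by (intro exI[of _ id]) simp
next
  assume "module_isomorphic (KP \<Lambda>) (path_module \<Lambda> x :: ('p, 'k, 'K) path_module)
      (path_module \<Lambda> y :: ('p, 'k, 'K) path_module)"
  then obtain \<phi> :: "(('p, 'k) ipath \<Rightarrow>\<^sub>0 'K) \<Rightarrow> (('p, 'k) ipath \<Rightarrow>\<^sub>0 'K)"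
    where bij: "bij_betw \<phi> {m. Poly_Mapping.keys m \<subseteq> tail_class \<Lambda> x} {m. Poly_Mapping.keys m \<subseteq> tail_class \<Lambda> y}"
      and add: "\<And>m m'. Poly_Mapping.keys m \<subseteq> tail_class \<Lambda> x \<Longrightarrow> Poly_Mapping.keys m' \<subseteq> tail_class \<Lambda> x
        \<Longrightarrow> \<phi> (m + m') = \<phi> m + \<phi> m'"
      and act: "\<And>a m. a \<in> acarrier (KP \<Lambda>) \<Longrightarrow> Poly_Mapping.keys m \<subseteq> tail_class \<Lambda> x
        \<Longrightarrow> \<phi> (kp_act \<Lambda> a m) = kp_act \<Lambda> a (\<phi> m)"
    by (auto simp: module_isomorphic_def)
  let ?x = "Poly_Mapping.single x (1 :: 'K)"
  have x_class: "Poly_Mapping.keys ?x \<subseteq> tail_class \<Lambda> x"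
    using x by (rule single_in_tail_class)
  have \<phi>x: "Poly_Mapping.keys (\<phi> ?x) \<subseteq> tail_class \<Lambda> y"
    using bij_betwE[OF bij] x_class by blast
  have \<phi>0: "\<phi> 0 = 0"
    using add[of 0 0] by simp
  show "tail_equiv x y"
  proof (rule ccontr)
    assume "\<not> tail_equiv x y"
    \<comment> \<open>The image of \<open>x\<close> is supported in [y], which does not contain
      \<open>x\<close>. Hence a ghost path that separates \<open>x\<close> from this support kills
      the image.\<close>
    then have x_notin: "x \<notin> Poly_Mapping.keys (\<phi> ?x)"
      using \<phi>x tail_equiv_sym by (auto simp: tail_class_def)
    have keys: "Poly_Mapping.keys (\<phi> ?x) \<subseteq> inf_paths \<Lambda>"
      using \<phi>x by (auto simp: tail_class_def)
    obtain n where n: "\<And>z. z \<in> Poly_Mapping.keys (\<phi> ?x) \<Longrightarrow> z (0, n) = x (0, n) \<Longrightarrow> z = x"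
      using separate_inf_paths[OF finite_keys keys x] by blast
    let ?f = "pth (x (0, n)) * gho (x (0, n)) :: ('p, 'K) free_alg"
    have f: "?f \<in> free_nalg \<Lambda>"
      using x by (intro free_nalg_times pth_free_nalg gho_free_nalg) simp_all
    have "free_act \<Lambda> (gho (x (0, n))) (\<phi> ?x) = 0"
      using free_act_gho_init_separating[OF x keys n] x_notin by (simp add: in_keys_iff)
    then have "free_act \<Lambda> ?f (\<phi> ?x) = 0"
      by (simp add: free_act_times free_act_zero_right)
    moreover have "free_act \<Lambda> ?f ?x = ?x"
      using x by (simp add: free_act_times free_act_gho_init_single free_act_pth_init_single)
    moreover have "\<phi> (free_act \<Lambda> ?f ?x) = free_act \<Lambda> ?f (\<phi> ?x)"
      using act[of "kp_class \<Lambda> ?f" ?x] f x_class \<phi>x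
      by (simp add: acarrier_KP kp_act_class[OF fin f])
    ultimately have "\<phi> ?x = \<phi> 0"
      using \<phi>0 by simp
    then have "?x = 0"
      using bij_betw_imp_inj_on[OF bij] x_class by (auto dest: inj_onD)
    then show False
      by (metis lookup_single_eq lookup_zero zero_neq_one)
  qed
qed

end

section \<open>Gradings\<close>

text \<open>The component of a vector at \<gamma> is its restriction to the block
  \<open>P \<gamma>\<close>. Blocks are indexed by all degrees and may be empty; since each basis
  element lies in exactly one block, the components exist and are unique.\<close>

lemma direct_sum_decomposition_keys:
  fixes M :: "('K::field, 'a, 'b \<Rightarrow>\<^sub>0 'K) lmod"
  assumes M: "mcarrier M = {m. Poly_Mapping.keys m \<subseteq> B}" "mscale M = pm_scale"
    and P: "\<And>\<gamma>. P \<gamma> \<subseteq> B" and ex1: "\<And>b. b \<in> B \<Longrightarrow> \<exists>!\<gamma>. b \<in> P \<gamma>"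
  shows "direct_sum_decomposition M (\<lambda>\<gamma>. {m. Poly_Mapping.keys m \<subseteq> P \<gamma>})"
  unfolding direct_sum_decomposition_def M
proof (intro conjI allI ballI subspace_keys_subset)
  show "{m :: 'b \<Rightarrow>\<^sub>0 'K. Poly_Mapping.keys m \<subseteq> P \<gamma>} \<subseteq> {m. Poly_Mapping.keys m \<subseteq> B}" for \<gamma>
    using P by blast
  fix m :: "'b \<Rightarrow>\<^sub>0 'K"
  assume "m \<in> {m. Poly_Mapping.keys m \<subseteq> B}"
  then have m: "Poly_Mapping.keys m \<subseteq> B" by simp
  have unique: "\<gamma> = \<delta>" if "b \<in> P \<gamma>" "b \<in> P \<delta>" for b \<gamma> \<delta>
    using ex1[of b] P that by blast
  let ?Q = "\<lambda>c. (\<forall>\<gamma>. c \<gamma> \<in> {m. Poly_Mapping.keys m \<subseteq> P \<gamma>}) \<and> finite {\<gamma>. c \<gamma> \<noteq> 0} \<and>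
    m = (\<Sum>\<gamma> | c \<gamma> \<noteq> 0. c \<gamma>)"
  define c where "c \<gamma> = (\<Sum>b \<in> {b \<in> Poly_Mapping.keys m. b \<in> P \<gamma>}.
    Poly_Mapping.single b (Poly_Mapping.lookup m b))" for \<gamma>
  have c: "Poly_Mapping.lookup (c \<gamma>) b = (if b \<in> P \<gamma> then Poly_Mapping.lookup m b else 0)" for \<gamma> b
    by (simp add: c_def lookup_sum lookup_single when_def in_keys_iff)
  \<comment> \<open>Uniqueness: at a basis element of \<open>P \<gamma>\<close> no other component
    contributes, so the coefficient there is that of \<open>m\<close>. The index set is enlarged by
    \<gamma> because \<open>c' \<gamma>\<close> might be 0.\<close>
  have lookup: "Poly_Mapping.lookup (c' \<gamma>) b = (if b \<in> P \<gamma> then Poly_Mapping.lookup m b else 0)"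
    if c': "?Q c'" for c' \<gamma> b
  proof (cases "b \<in> P \<gamma>")
    case True
    have other: "Poly_Mapping.lookup (c' \<delta>) b = 0" if "\<delta> \<noteq> \<gamma>" for \<delta>
      using c' unique[OF True] that by (auto simp: in_keys_iff subset_iff)
    from c' have "m = (\<Sum>\<delta> | c' \<delta> \<noteq> 0. c' \<delta>)"
      by (elim conjE)
    then have "Poly_Mapping.lookup m b = Poly_Mapping.lookup (\<Sum>\<delta> | c' \<delta> \<noteq> 0. c' \<delta>) b"
      by (rule arg_cong)
    also have "\<dots> = (\<Sum>\<delta> | c' \<delta> \<noteq> 0. Poly_Mapping.lookup (c' \<delta>) b)"
      by (rule lookup_sum)
    also have "\<dots> = (\<Sum>\<delta> \<in> insert \<gamma> {\<delta>. c' \<delta> \<noteq> 0}. Poly_Mapping.lookup (c' \<delta>) b)"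
      using c' by (intro sum.mono_neutral_left) auto
    also have "\<dots> = (\<Sum>\<delta> \<in> {\<gamma>}. Poly_Mapping.lookup (c' \<delta>) b)"
      using c' other by (intro sum.mono_neutral_right) auto
    finally show ?thesis using True by simp
  next
    case False
    then show ?thesis using c' by (auto simp: in_keys_iff subset_iff)
  qed
  \<comment> \<open>\<open>h\<close> picks the block of a basis element. The finitely many blocks
    met by the support of \<open>m\<close> bound the set of nonzero components.\<close>
  obtain h where h: "\<And>b. b \<in> B \<Longrightarrow> b \<in> P (h b)"
    using ex1 by metis
  have c_support: "{\<gamma>. c \<gamma> \<noteq> 0} \<subseteq> h ` Poly_Mapping.keys m"
  proof
    fix \<gamma> assume "\<gamma> \<in> {\<gamma>. c \<gamma> \<noteq> 0}"
    then obtain b where "Poly_Mapping.lookup (c \<gamma>) b \<noteq> 0"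
      by (metis mem_Collect_eq poly_mapping_eqI lookup_zero)
    then have b: "b \<in> P \<gamma>" "b \<in> Poly_Mapping.keys m"
      by (auto simp: c in_keys_iff split: if_splits)
    then show "\<gamma> \<in> h ` Poly_Mapping.keys m"
      using unique[OF b(1) h] m by blast
  qed
  have "?Q c"
  proof (intro conjI allI)
    show "c \<gamma> \<in> {m. Poly_Mapping.keys m \<subseteq> P \<gamma>}" for \<gamma>
      by (auto simp: in_keys_iff c split: if_splits)
    show "finite {\<gamma>. c \<gamma> \<noteq> 0}"
      by (rule finite_subset[OF c_support]) simp
    show "m = (\<Sum>\<gamma> | c \<gamma> \<noteq> 0. c \<gamma>)"
    proof (rule poly_mapping_eqI)
      fix b
      have "Poly_Mapping.lookup (\<Sum>\<gamma> | c \<gamma> \<noteq> 0. c \<gamma>) b =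
          (\<Sum>\<gamma> \<in> h ` Poly_Mapping.keys m. Poly_Mapping.lookup (c \<gamma>) b)"
        unfolding lookup_sum using c_support by (intro sum.mono_neutral_left) auto
      also have "\<dots> = Poly_Mapping.lookup m b"
      proof (cases "b \<in> Poly_Mapping.keys m")
        case True
        then have "b \<in> P \<gamma> \<longleftrightarrow> \<gamma> = h b" for \<gamma>
          using h[of b] m unique by blast
        then show ?thesis using True by (simp add: c)
      qed (simp add: c in_keys_iff cong: if_cong)
      finally show "Poly_Mapping.lookup m b = Poly_Mapping.lookup (\<Sum>\<gamma> | c \<gamma> \<noteq> 0. c \<gamma>) b"
        by (rule sym)
    qed
  qed
  moreover have "c' = c" if "?Q c'" for c'
    by (rule ext, rule poly_mapping_eqI) (simp only: lookup[OF that] c)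
  ultimately show "\<exists>!c. ?Q c"
    by (rule ex1I)
qed

text \<open>Translation by -\<alpha> maps \<open>F\<close> injectively into itself, hence permutes
  the finite set \<open>F\<close>. For some i with \<alpha> i nonzero, comparing the sums of the
  i-th coordinates before and after gives card F * \<alpha> i = 0.\<close>

lemma finite_translation_invariant_empty:
  fixes \<alpha> :: "'k \<Rightarrow> int"
  assumes fin: "finite F" and inv: "\<And>\<gamma>. \<gamma> \<in> F \<Longrightarrow> \<gamma> - \<alpha> \<in> F" and \<alpha>: "\<alpha> \<noteq> 0"
  shows "F = {}"
proof -
  obtain i where i: "\<alpha> i \<noteq> 0"
    using \<alpha> by (auto simp: fun_eq_iff)
  have inj: "inj_on (\<lambda>\<gamma>. \<gamma> - \<alpha>) F"
    by (auto simp: inj_on_def)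
  then have "(\<lambda>\<gamma>. \<gamma> - \<alpha>) ` F = F"
    using inv by (intro endo_inj_surj[OF fin]) auto
  then have "(\<Sum>\<gamma> \<in> F. \<gamma> i) = (\<Sum>\<gamma> \<in> F. (\<gamma> - \<alpha>) i)"
    using sum.reindex[OF inj, of "\<lambda>\<gamma>. \<gamma> i"] by simp
  then have "int (card F) * \<alpha> i = 0"
    by (simp add: sum_subtractf)
  then show ?thesis
    using i fin by simp
qed

lemma int_diff_eq_iff:
  "(\<lambda>i. int (m i) - int (n i)) = (\<lambda>i. int (m' i) - int (n' i)) \<longleftrightarrow> m + n' = m' + n"
  unfolding fun_eq_iff plus_fun_apply by (rule iff_allI) linarith

section \<open>The grading by lag, and the obstruction from periodicity\<close>

context k_graph
begin

text \<open>The paths in the class of \<open>x\<close> that lag behind \<open>x\<close> by \<open>\<gamma>\<close>; if \<open>x\<close> is aperiodic, they are a basis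
  of the component of degree \<open>\<gamma>\<close>.\<close>

definition lag_set :: "('p, 'k) ipath \<Rightarrow> ('k \<Rightarrow> int) \<Rightarrow> ('p, 'k) ipath set" where
  "lag_set x \<gamma> = {y \<in> inf_paths \<Lambda>.
     \<exists>m n. tail y m = tail x n \<and> \<gamma> = (\<lambda>i. int (m i) - int (n i))}"

lemma lag_setI:
  assumes "y \<in> inf_paths \<Lambda>" "tail y m = tail x n" "\<gamma> = (\<lambda>i. int (m i) - int (n i))"
  shows "y \<in> lag_set x \<gamma>"
  unfolding lag_set_def using assms by blast

lemma lag_set_subset_tail_class: "lag_set x \<gamma> \<subseteq> tail_class \<Lambda> x"
proof
  fix y assume "y \<in> lag_set x \<gamma>"
  then obtain m n where y: "y \<in> inf_paths \<Lambda>" and t: "tail y m = tail x n"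
    unfolding lag_set_def by blast
  have "tail_equiv x y"
    unfolding tail_equiv_def by (intro exI) (rule sym[OF t])
  with y show "y \<in> tail_class \<Lambda> x"
    by (simp add: tail_class_def)
qed

text \<open>A lag exists by tail equivalence. Two witnesses (m, n) and (m', n') describe the tail of
  \<open>y\<close> at m + m' as the tails of \<open>x\<close> at n + m' and at n' + m; aperiodicity
  equates these degrees, and so the two differences.\<close>

lemma ex1_lag_set:
  assumes x: "aperiodic x" and y: "y \<in> tail_class \<Lambda> x"
  shows "\<exists>!\<gamma>. y \<in> lag_set x \<gamma>"
proof (rule ex_ex1I)
  show "\<exists>\<gamma>. y \<in> lag_set x \<gamma>"
  proof -
    obtain n m where y_inf: "y \<in> inf_paths \<Lambda>" and t: "tail x n = tail y m"
      using y unfolding tail_class_def tail_equiv_def by blast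
    have "y \<in> lag_set x (\<lambda>i. int (m i) - int (n i))"
      using y_inf t[symmetric] refl by (rule lag_setI)
    then show ?thesis by blast
  qed
next
  fix \<gamma> \<delta>
  assume "y \<in> lag_set x \<gamma>" "y \<in> lag_set x \<delta>"
  then obtain m n m' n' where t: "tail y m = tail x n" "tail y m' = tail x n'"
    and \<gamma>: "\<gamma> = (\<lambda>i. int (m i) - int (n i))" and \<delta>: "\<delta> = (\<lambda>i. int (m' i) - int (n' i))"
    unfolding lag_set_def by blast
  have "tail x (n + m') = tail x (n' + m)"
    by (metis t tail_tail add.commute)
  then have "n + m' = n' + m"
    using x by (simp add: aperiodic_def)
  then show "\<gamma> = \<delta>"
    unfolding \<gamma> \<delta> int_diff_eq_iff by (simp add: add.commute)
qed

text \<open>After \<mu> is replaced by \<eta>, the tail at d(\<eta>) + m is the tail of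
  \<open>y\<close> at d(\<mu>) + m, which is the tail of \<open>x\<close> at n + d(\<mu>). So the
  lag grows by d(\<eta>) - d(\<mu>).\<close>

lemma prepend_tail_lag_set:
  assumes y: "y \<in> lag_set x \<gamma>" and \<eta>: "\<eta> \<in> Mor \<Lambda>" and s: "src \<Lambda> \<eta> = src \<Lambda> \<mu>"
    and \<mu>: "y (0, deg \<Lambda> \<mu>) = \<mu>" and \<alpha>: "\<alpha> = (\<lambda>i. int (deg \<Lambda> \<eta> i) - int (deg \<Lambda> \<mu> i))"
  shows "prepend \<Lambda> \<eta> (tail y (deg \<Lambda> \<mu>)) \<in> lag_set x (\<alpha> + \<gamma>)"
proof -
  let ?t = "tail y (deg \<Lambda> \<mu>)" and ?z = "prepend \<Lambda> \<eta> (tail y (deg \<Lambda> \<mu>))"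
  obtain m n where t: "tail y m = tail x n" and \<gamma>: "\<gamma> = (\<lambda>i. int (m i) - int (n i))"
    and y_inf: "y \<in> inf_paths \<Lambda>"
    using y by (auto simp: lag_set_def)
  have "?t (0, 0) = src \<Lambda> \<eta>"
    using inf_path_init_src[OF y_inf \<mu>] s by simp
  then have z: "?z \<in> inf_paths \<Lambda>" "tail ?z (deg \<Lambda> \<eta>) = ?t"
    using \<eta> y_inf by simp_all
  have "tail ?z (deg \<Lambda> \<eta> + m) = tail x (n + deg \<Lambda> \<mu>)"
    by (metis z(2) t tail_tail add.commute)
  moreover have "\<alpha> + \<gamma> = (\<lambda>i. int ((deg \<Lambda> \<eta> + m) i) - int ((n + deg \<Lambda> \<mu>) i))"
    by (auto simp: \<alpha> \<gamma> fun_eq_iff)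
  ultimately show ?thesis
    by (rule lag_setI[OF z(1)])
qed

lemma graded_path_module_if_aperiodic:
  assumes fin: "row_finite \<Lambda>" and x: "x \<in> inf_paths \<Lambda>" and ap: "aperiodic x"
  shows "graded_module (KP_component \<Lambda>) (path_module \<Lambda> x :: ('p, 'k, 'K::field) path_module)"
  unfolding graded_module_def
proof (intro exI conjI allI ballI)
  let ?V = "\<lambda>\<gamma>. {m :: ('p, 'k) ipath \<Rightarrow>\<^sub>0 'K. Poly_Mapping.keys m \<subseteq> lag_set x \<gamma>}"
  show "direct_sum_decomposition (path_module \<Lambda> x) ?V"
    by (rule direct_sum_decomposition_keys[where B = "tail_class \<Lambda> x"])
      (simp_all add: lag_set_subset_tail_class ex1_lag_set[OF ap])
  fix \<alpha> \<gamma> and a :: "('p, 'K) kp_elem" and m :: "('p, 'k) ipath \<Rightarrow>\<^sub>0 'K"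
  assume a: "a \<in> KP_component \<Lambda> \<alpha>" and m: "m \<in> ?V \<gamma>"
  let ?G = "{pth \<eta> * gho \<mu> :: ('p, 'K) free_alg | \<eta> \<mu>. \<eta> \<in> Mor \<Lambda> \<and> \<mu> \<in> Mor \<Lambda> \<and>
    src \<Lambda> \<eta> = src \<Lambda> \<mu> \<and> \<alpha> = (\<lambda>i. int (deg \<Lambda> \<eta> i) - int (deg \<Lambda> \<mu> i))}"
  obtain f where f: "f \<in> pm.span ?G" and a_eq: "a = kp_class \<Lambda> f"
    using a unfolding KP_component_def by (rule imageE)
  \<comment> \<open>The elements that move \<open>m\<close> into degree \<alpha> + \<gamma> form a
    subspace, so testing the spanning products suffices. Membership in
    \<open>free_nalg \<Lambda>\<close> is carried along because \<open>kp_act_class\<close> requires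
    it.\<close>
  let ?T = "{g \<in> free_nalg \<Lambda>. free_act \<Lambda> g m \<in> ?V (\<alpha> + \<gamma>)}"
  have gens: "g \<in> ?T" if g_in: "g \<in> ?G" for g
  proof -
    obtain \<eta> \<mu> where g: "g = pth \<eta> * gho \<mu>" and \<eta>: "\<eta> \<in> Mor \<Lambda>" and \<mu>: "\<mu> \<in> Mor \<Lambda>"
      and s: "src \<Lambda> \<eta> = src \<Lambda> \<mu>" and \<alpha>: "\<alpha> = (\<lambda>i. int (deg \<Lambda> \<eta> i) - int (deg \<Lambda> \<mu> i))"
      using g_in by (elim CollectE exE conjE) (rule that)
    have "free_act \<Lambda> g (Poly_Mapping.single y 1) \<in> ?V (\<alpha> + \<gamma>)" if "y \<in> Poly_Mapping.keys m" for y
    proof -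
      have y: "y \<in> lag_set x \<gamma>"
        using m that by blast
      then have "y \<in> inf_paths \<Lambda>"
        by (simp add: lag_set_def)
      then show ?thesis
        using prepend_tail_lag_set[OF y \<eta> s _ \<alpha>] by (simp add: g free_act_pth_gho_single[OF s])
    qed
    then have "free_act \<Lambda> g m \<in> ?V (\<alpha> + \<gamma>)"
      by (subst free_act_expand)
        (intro pm.subspace_sum[OF subspace_keys_subset] pm.subspace_scale[OF subspace_keys_subset])
    moreover have "g \<in> free_nalg \<Lambda>"
      unfolding g using \<eta> \<mu> by (intro free_nalg_times pth_free_nalg gho_free_nalg)
    ultimately show ?thesis by simp
  qed
  have subspace: "pm.subspace ?T"
  proof (rule pm.subspaceI)
    show "0 \<in> ?T"
      by (simp add: free_nalg_def free_act_zero_left)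
    fix g h :: "('p, 'K) free_alg" and c
    assume g: "g \<in> ?T"
    then show "pm_scale c g \<in> ?T"
      using pm.subspace_scale[OF subspace_keys_subset, of "free_act \<Lambda> g m" "lag_set x (\<alpha> + \<gamma>)" c]
      by (simp add: free_nalg_scale free_act_scale_left)
    assume "h \<in> ?T"
    then show "g + h \<in> ?T"
      using g pm.subspace_add[OF subspace_keys_subset, of "free_act \<Lambda> g m" "lag_set x (\<alpha> + \<gamma>)" "free_act \<Lambda> h m"]
      by (simp add: free_nalg_plus free_act_add_left)
  qed
  have "f \<in> ?T"
    by (rule subsetD[OF pm.span_minimal[OF subsetI[OF gens] subspace] f])
  moreover have "Poly_Mapping.keys m \<subseteq> tail_class \<Lambda> x"
    using m lag_set_subset_tail_class by blast
  ultimately show "mact (path_module \<Lambda> x) a m \<in> ?V (\<alpha> + \<gamma>)"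
    by (simp add: a_eq kp_act_class[OF fin])
qed

lemma aperiodic_if_graded_path_module:
  assumes fin: "row_finite \<Lambda>" and x: "x \<in> inf_paths \<Lambda>"
    and graded: "graded_module (KP_component \<Lambda>) (path_module \<Lambda> x :: ('p, 'k, 'K::field) path_module)"
  shows "aperiodic x"
  unfolding aperiodic_def
proof (intro allI impI, rule ccontr)
  fix n m
  assume t: "tail x n = tail x m" and "n \<noteq> m"
  let ?M = "path_module \<Lambda> x :: ('p, 'k, 'K) path_module"
  let ?x = "Poly_Mapping.single x (1 :: 'K)"
  let ?f = "pth (x (0, n)) * gho (x (0, m)) :: ('p, 'K) free_alg"
  define \<alpha> where "\<alpha> = (\<lambda>i. int (n i) - int (m i))"
  have \<alpha>: "\<alpha> \<noteq> 0"
    using \<open>n \<noteq> m\<close> by (auto simp: \<alpha>_def fun_eq_iff)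
  obtain V where dec: "direct_sum_decomposition ?M V"
    and V_act: "\<And>\<alpha> \<gamma> a m. a \<in> KP_component \<Lambda> \<alpha> \<Longrightarrow> m \<in> V \<gamma> \<Longrightarrow> kp_act \<Lambda> a m \<in> V (\<alpha> + \<gamma>)"
    using graded by (auto simp: graded_module_def)
  have V: "Poly_Mapping.keys v \<subseteq> tail_class \<Lambda> x" if "v \<in> V \<gamma>" for v \<gamma>
    using dec that by (auto simp: direct_sum_decomposition_def)
  have ex1: "\<exists>!c. (\<forall>\<gamma>. c \<gamma> \<in> V \<gamma>) \<and> finite {\<gamma>. c \<gamma> \<noteq> 0} \<and> ?x = (\<Sum>\<gamma> | c \<gamma> \<noteq> 0. c \<gamma>)"
    using dec single_in_tail_class[OF x, of "1 :: 'K"] by (simp add: direct_sum_decomposition_def)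
  then obtain c where c: "\<And>\<gamma>. c \<gamma> \<in> V \<gamma>" "finite {\<gamma>. c \<gamma> \<noteq> 0}" "?x = (\<Sum>\<gamma> | c \<gamma> \<noteq> 0. c \<gamma>)"
    by blast
  \<comment> \<open>The common tail starts at one vertex, so x(0, n) and x(0, m) have the same
    source and \<open>?f\<close> is one of the spanning elements of degree \<alpha>.\<close>
  have "tail x n (0, 0) = tail x m (0, 0)"
    using t by simp
  then have s: "x (n, n) = x (m, m)"
    by simp
  have f: "?f \<in> free_nalg \<Lambda>"
    using x by (intro free_nalg_times pth_free_nalg gho_free_nalg) simp_all
  have "?f \<in> {pth \<eta> * gho \<mu> | \<eta> \<mu>. \<eta> \<in> Mor \<Lambda> \<and> \<mu> \<in> Mor \<Lambda> \<and>
      src \<Lambda> \<eta> = src \<Lambda> \<mu> \<and> \<alpha> = (\<lambda>i. int (deg \<Lambda> \<eta> i) - int (deg \<Lambda> \<mu> i))}"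
    by (rule CollectI, rule exI[of _ "x (0, n)"], rule exI[of _ "x (0, m)"])
      (use x s in \<open>simp add: \<alpha>_def\<close>)
  then have f_comp: "kp_class \<Lambda> ?f \<in> KP_component \<Lambda> \<alpha>"
    unfolding KP_component_def by (intro imageI pm.span_base)
  have f_V: "free_act \<Lambda> ?f v \<in> V (\<alpha> + \<gamma>)" if "v \<in> V \<gamma>" for v \<gamma>
    using V_act[OF f_comp that] by (simp only: kp_act_class[OF fin f V[OF that]])
  have fx: "free_act \<Lambda> ?f ?x = ?x"
    using x free_act_pth_init_single[OF x, of n]
    by (simp add: free_act_times free_act_gho_init_single t)
  \<comment> \<open>Applying \<open>?f\<close>, which fixes \<open>x\<close>, to the decomposition
    of \<open>x\<close> yields another one, whose component in degree \<gamma> comes from degree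
    \<gamma> - \<alpha>. Uniqueness of the decomposition will give \<open>c' = c\<close>.\<close>
  define c' where "c' \<gamma> = free_act \<Lambda> ?f (c (\<gamma> - \<alpha>))" for \<gamma>
  have "c' \<gamma> \<in> V \<gamma>" for \<gamma>
    using f_V[OF c(1), of "\<gamma> - \<alpha>"] by (simp add: c'_def)
  \<comment> \<open>Only an inclusion is claimed at this point, since \<open>?f\<close> might kill
    some components.\<close>
  moreover have supp: "{\<gamma>. c' \<gamma> \<noteq> 0} \<subseteq> (\<lambda>\<gamma>. \<gamma> + \<alpha>) ` {\<gamma>. c \<gamma> \<noteq> 0}"
  proof
    fix \<gamma> assume "\<gamma> \<in> {\<gamma>. c' \<gamma> \<noteq> 0}"
    then have "c (\<gamma> - \<alpha>) \<noteq> 0"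
      by (auto simp: c'_def free_act_zero_right)
    then show "\<gamma> \<in> (\<lambda>\<gamma>. \<gamma> + \<alpha>) ` {\<gamma>. c \<gamma> \<noteq> 0}"
      by (intro image_eqI[of _ _ "\<gamma> - \<alpha>"]) simp_all
  qed
  moreover from supp have "finite {\<gamma>. c' \<gamma> \<noteq> 0}"
    using c(2) by (rule finite_subset[OF _ finite_imageI])
  moreover have "?x = (\<Sum>\<gamma> | c' \<gamma> \<noteq> 0. c' \<gamma>)"
  proof -
    have "?x = free_act \<Lambda> ?f (\<Sum>\<gamma> | c \<gamma> \<noteq> 0. c \<gamma>)"
      using fx c(3) by simp
    also have "\<dots> = (\<Sum>\<gamma> | c \<gamma> \<noteq> 0. c' (\<gamma> + \<alpha>))"
      by (simp add: free_act_sum_right c'_def)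
    also have "\<dots> = (\<Sum>\<gamma> \<in> (\<lambda>\<gamma>. \<gamma> + \<alpha>) ` {\<gamma>. c \<gamma> \<noteq> 0}. c' \<gamma>)"
      by (simp add: sum.reindex inj_on_def)
    also have "\<dots> = (\<Sum>\<gamma> | c' \<gamma> \<noteq> 0. c' \<gamma>)"
      using supp c(2) by (intro sum.mono_neutral_right) auto
    finally show ?thesis .
  qed
  ultimately have "c' = c"
    using ex1 c by blast
  then have c_shift: "c \<gamma> = free_act \<Lambda> ?f (c (\<gamma> - \<alpha>))" for \<gamma>
    unfolding c'_def by (rule fun_cong[symmetric])
  \<comment> \<open>A nonzero component in degree \<gamma> is the image of the one in degree
    \<gamma> - \<alpha>, which is therefore nonzero as well.\<close>
  have "{\<gamma>. c \<gamma> \<noteq> 0} = {}"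
  proof (rule finite_translation_invariant_empty[OF c(2) _ \<alpha>])
    show "\<gamma> - \<alpha> \<in> {\<gamma>. c \<gamma> \<noteq> 0}" if "\<gamma> \<in> {\<gamma>. c \<gamma> \<noteq> 0}" for \<gamma>
      using that c_shift[of \<gamma>] by (auto simp: free_act_zero_right)
  qed
  then have "?x = 0"
    using c(3) by (simp only: sum.empty)
  then show False
    by (metis lookup_single_eq lookup_zero zero_neq_one)
qed

end

theorem corollary7p7:
  fixes \<Lambda> :: "('p, 'k::finite) kgraph"
  assumes "k_graph \<Lambda>" and "row_finite \<Lambda>" and "no_sources \<Lambda>"
  shows "(\<forall>x \<in> inf_paths \<Lambda>.
            simple_module (KP \<Lambda>) (path_module \<Lambda> x :: ('p, 'k, 'K::field) path_module)) \<and>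
         (\<forall>x \<in> inf_paths \<Lambda>. \<forall>y \<in> inf_paths \<Lambda>.
            module_isomorphic (KP \<Lambda>) (path_module \<Lambda> x :: ('p, 'k, 'K) path_module)
              (path_module \<Lambda> y :: ('p, 'k, 'K) path_module) \<longleftrightarrow> tail_equiv x y) \<and>
         (\<forall>x \<in> inf_paths \<Lambda>.
            graded_module (KP_component \<Lambda>) (path_module \<Lambda> x :: ('p, 'k, 'K) path_module)
              \<longleftrightarrow> aperiodic x)"
proof -
  interpret k_graph \<Lambda> by fact
  show ?thesis
    using assms(2) simple_path_module path_module_isomorphic_iff
      graded_path_module_if_aperiodic aperiodic_if_graded_path_module by blast
qed

end
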